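(* Let $F:\mathbf{Comp}\to\mathbf{Comp}$ be a monomorphic functor with finite supports. Then its maximal $\emptyset$-modification $F^\circ:\mathbf{Comp}\to\mathbf{Comp}$ is a monomorphic, epimorphic, continuous, intersection preserving functor with finite supports. Moreover, the functors $F$ and $F^\circ$ preserve the weight of infinite compacta if and only if for every $n\in\omega$ the space $Fn$ is metrizable.
   Context: $\mathbf{Comp}$ is the category of compact Hausdorff spaces (compacta, including $\emptyset$) and their continuous maps. A functor $F:\mathbf{Comp}\to\mathbf{Comp}$ is monomorphic if it preserves monomorphisms (injective maps), epimorphic if it preserves epimorphisms (surjective maps), and continuous if it preserves the limits of inverse spectra in $\mathbf{Comp}$. It has finite supports if for each compact Hausdorff space $X$ and each $a\in FX$ there is a map $f:A\to X$ from a finite discrete space $A$ such that $a\in Ff(FA)$. For compact Hausdorff spaces $A\subset B$, $i^A_B:A\to B$ denotes the identity embedding; $F$ preserves intersections if for any compact Hausdorff space $X$ and any closed subsets $X_\alpha\subset X$, $\alpha\in A$, with intersection $Z=\bigcap_{\alpha\in A}X_\alpha$, one has $F i^Z_X(FZ)=\bigcap_{\alpha\in A}F i^{X_\alpha}_X(FX_\alpha)$. A finite ordinal $n$ is identified with the finite discrete space $\{0,\dots,n-1\}$. The weight $w(X)$ of a topological space $X$ is the smallest cardinality of a base of its topology. A functor $F:\mathbf{Comp}\to\mathbf{Comp}$ preserves the weight of infinite compacta if $w(FX)=w(X)$ for every infinite compact Hausdorff space $X$. An $\emptyset$-modification of a monomorphic functor $F$ is a monomorphic functor $\tilde F$ with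 $\tilde FX=FX$ for each non-empty $X$. The maximal $\emptyset$-modification $F^\circ$ of $F$ is defined as follows. On objects: $F^\circ X=FX$ for non-empty $X$, and $F^\circ\emptyset=\{a\in F1: Ff_0(a)=Ff_1(a)\}\subset F1$ (with the subspace topology), where, for $i\in\{0,1\}$, $f_i:1\to 2$ is the constant map with value $i$. On a morphism $f:X\to Y$: $F^\circ f=Ff$ if $X\neq\emptyset$; $F^\circ f$ is the identity of $F^\circ\emptyset$ if $X=Y=\emptyset$; and if $X=\emptyset\ne Y$, then $F^\circ f=Fg|_{F^\circ\emptyset}:F^\circ\emptyset\to F^\circ Y=FY$, where $g:1\to Y$ is any map (the result does not depend on $g$).
   Formalization: The "if" part of the weight claim is proved only for F not naturally isomorphic, on non-empty compacta, to a constant functor; it fails for the constant functor FX = 1. "Only if" and the other properties are proved for all F. *)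

theory Defs
  imports "HOL-Analysis.Analysis" "HOL-Library.Infinite_Typeclass"
begin

unbundle cardinal_syntax
no_notation elt_set_eq (infix \<open>=o\<close> 50)

text \<open>
  HOL has no type of all sets, so compacta are topologies on subsets of an arbitrary infinite
  type \<open>'a\<close>. A functor takes such compacta to compacta over a type \<open>'b\<close>, which may be
  \<open>'a\<close> itself. Keeping \<open>'b\<close> separate loses nothing: the values of a functor on all
  compacta over \<open>'a\<close> form a set of spaces, which fits into some type.

  A morphism \<open>X \<rightarrow> Y\<close> is a function \<open>'a \<Rightarrow> 'a\<close> that is continuous from \<open>X\<close>
  to \<open>Y\<close>; its values outside \<open>topspace X\<close> are irrelevant.
\<close>

definition compactum :: "'a topology \<Rightarrow> bool" where
  "compactum X \<longleftrightarrow> compact_space X \<and> Hausdorff_space X"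

record ('a, 'b) functor_data =
  obj :: "'a topology \<Rightarrow> 'b topology"
  mor :: "'a topology \<Rightarrow> 'a topology \<Rightarrow> ('a \<Rightarrow> 'a) \<Rightarrow> 'b \<Rightarrow> 'b"

definition comp_functor :: "('a, 'b) functor_data \<Rightarrow> bool" where
  "comp_functor F \<longleftrightarrow>
     (\<forall>X. compactum X \<longrightarrow> compactum (obj F X)) \<and>
     (\<forall>X Y f. compactum X \<and> compactum Y \<and> continuous_map X Y f
        \<longrightarrow> continuous_map (obj F X) (obj F Y) (mor F X Y f)) \<and>
     (\<forall>X Y f g. compactum X \<and> compactum Y \<and> continuous_map X Y f \<and> (\<forall>x\<in>topspace X. f x = g x)
        \<longrightarrow> (\<forall>a\<in>topspace (obj F X). mor F X Y f a = mor F X Y g a)) \<and>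
     (\<forall>X. compactum X \<longrightarrow> (\<forall>a\<in>topspace (obj F X). mor F X X id a = a)) \<and>
     (\<forall>X Y Z f g. compactum X \<and> compactum Y \<and> compactum Z \<and>
                   continuous_map X Y f \<and> continuous_map Y Z g
        \<longrightarrow> (\<forall>a\<in>topspace (obj F X). mor F X Z (g \<circ> f) a = mor F Y Z g (mor F X Y f a)))"

definition monomorphic :: "('a, 'b) functor_data \<Rightarrow> bool" where
  "monomorphic F \<longleftrightarrow>
     (\<forall>X Y f. compactum X \<and> compactum Y \<and> continuous_map X Y f \<and> inj_on f (topspace X)
        \<longrightarrow> inj_on (mor F X Y f) (topspace (obj F X)))"

definition epimorphic :: "('a, 'b) functor_data \<Rightarrow> bool" where
  "epimorphic F \<longleftrightarrow>
     (\<forall>X Y f. compactum X \<and> compactum Y \<and> continuous_map X Y f \<and> f ` topspace X = topspace Y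
        \<longrightarrow> mor F X Y f ` topspace (obj F X) = topspace (obj F Y))"

definition finite_supports :: "('a, 'b) functor_data \<Rightarrow> bool" where
  "finite_supports F \<longleftrightarrow>
     (\<forall>X. compactum X \<longrightarrow> (\<forall>a\<in>topspace (obj F X).
        \<exists>A f. finite A \<and> continuous_map (discrete_topology A) X f \<and>
              a \<in> mor F (discrete_topology A) X f ` topspace (obj F (discrete_topology A))))"

definition preserves_intersections :: "('a, 'b) functor_data \<Rightarrow> bool" where
  "preserves_intersections F \<longleftrightarrow>
     (\<forall>X \<A>. compactum X \<and> \<A> \<noteq> {} \<and> (\<forall>A\<in>\<A>. closedin X A)
        \<longrightarrow> mor F (subtopology X (\<Inter>\<A>)) X id ` topspace (obj F (subtopology X (\<Inter>\<A>)))
            = (\<Inter>A\<in>\<A>. mor F (subtopology X A) X id ` topspace (obj F (subtopology X A))))"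

definition inverse_spectrum ::
  "'i set \<Rightarrow> ('i \<Rightarrow> 'i \<Rightarrow> bool) \<Rightarrow> ('i \<Rightarrow> 'a topology) \<Rightarrow> ('i \<Rightarrow> 'i \<Rightarrow> 'a \<Rightarrow> 'a) \<Rightarrow> bool" where
  "inverse_spectrum I le X p \<longleftrightarrow>
     I \<noteq> {} \<and> (\<forall>i\<in>I. le i i) \<and>
     (\<forall>i\<in>I. \<forall>j\<in>I. \<forall>k\<in>I. le i j \<and> le j k \<longrightarrow> le i k) \<and>
     (\<forall>i\<in>I. \<forall>j\<in>I. \<exists>k\<in>I. le i k \<and> le j k) \<and>
     (\<forall>i\<in>I. compactum (X i)) \<and>
     (\<forall>i\<in>I. \<forall>j\<in>I. le i j \<longrightarrow> continuous_map (X j) (X i) (p i j)) \<and>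
     (\<forall>i\<in>I. \<forall>x\<in>topspace (X i). p i i x = x) \<and>
     (\<forall>i\<in>I. \<forall>j\<in>I. \<forall>k\<in>I. le i j \<and> le j k
        \<longrightarrow> (\<forall>x\<in>topspace (X k). p i j (p j k x) = p i k x))"

definition threads ::
  "'i set \<Rightarrow> ('i \<Rightarrow> 'i \<Rightarrow> bool) \<Rightarrow> ('i \<Rightarrow> 'a topology) \<Rightarrow> ('i \<Rightarrow> 'i \<Rightarrow> 'a \<Rightarrow> 'a) \<Rightarrow> ('i \<Rightarrow> 'a) set" where
  "threads I le X p =
     {t \<in> (\<Pi>\<^sub>E i\<in>I. topspace (X i)). \<forall>i\<in>I. \<forall>j\<in>I. le i j \<longrightarrow> p i j (t j) = t i}"

text \<open>
  The limit of a spectrum is the space of threads in the Tychonoff product, up to homeomorphism: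
  \<open>L\<close> with projections \<open>\<pi> i\<close> is a limit if the map induced by the \<open>\<pi> i\<close> is a
  homeomorphism onto the space of threads. This makes \<open>(L, \<pi>)\<close> a cone over the spectrum.
\<close>

definition spectrum_limit ::
  "'i set \<Rightarrow> ('i \<Rightarrow> 'i \<Rightarrow> bool) \<Rightarrow> ('i \<Rightarrow> 'a topology) \<Rightarrow> ('i \<Rightarrow> 'i \<Rightarrow> 'a \<Rightarrow> 'a)
     \<Rightarrow> 'a topology \<Rightarrow> ('i \<Rightarrow> 'a \<Rightarrow> 'a) \<Rightarrow> bool" where
  "spectrum_limit I le X p L \<pi> \<longleftrightarrow>
     homeomorphic_map L (subtopology (product_topology X I) (threads I le X p))
       (\<lambda>x. \<lambda>i\<in>I. \<pi> i x)"

text \<open>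
  The type of indices cannot be quantified inside a formula, hence the \<open>itself\<close> argument.
\<close>

definition continuous_functor :: "'i itself \<Rightarrow> ('a, 'b) functor_data \<Rightarrow> bool" where
  "continuous_functor T F \<longleftrightarrow>
     (\<forall>(I :: 'i set) le X p L \<pi>.
        inverse_spectrum I le X p \<and> compactum L \<and> spectrum_limit I le X p L \<pi>
        \<longrightarrow> spectrum_limit I le (\<lambda>i. obj F (X i)) (\<lambda>i j. mor F (X j) (X i) (p i j))
              (obj F L) (\<lambda>i. mor F L (X i) (\<pi> i)))"

text \<open>
  Finite ordinals as discrete spaces over \<open>'a\<close>, by an arbitrary embedding of the natural
  numbers; \<open>ord_pt i\<close> stands for the element \<open>i\<close> of \<open>{0, \<dots>, n - 1}\<close>.
\<close>

definition ord_pt :: "nat \<Rightarrow> 'a::infinite" where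
  "ord_pt = (SOME e. inj e)"

lemma inj_ord_pt: "inj (ord_pt :: nat \<Rightarrow> 'a::infinite)"
proof -
  have "\<exists>e :: nat \<Rightarrow> 'a. inj e"
    using infinite_countable_subset[OF infinite_UNIV] by blast
  then show ?thesis
    unfolding ord_pt_def by (rule someI_ex)
qed

definition ordinal :: "nat \<Rightarrow> 'a::infinite topology" where
  "ordinal n = discrete_topology (ord_pt ` {..<n})"

text \<open>
  In the last case of the action on morphisms any map from \<open>ordinal 1\<close> to \<open>Y\<close>
  gives the same result if \<open>F\<close> is a functor; a constant one is chosen.
\<close>

definition max_mod :: "('a::infinite, 'b) functor_data \<Rightarrow> ('a, 'b) functor_data" where
  "max_mod F = \<lparr>
     obj = (\<lambda>X. if topspace X \<noteq> {} then obj F X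
                else subtopology (obj F (ordinal 1))
                       {a \<in> topspace (obj F (ordinal 1)).
                          mor F (ordinal 1) (ordinal 2) (\<lambda>_. ord_pt 0) a
                        = mor F (ordinal 1) (ordinal 2) (\<lambda>_. ord_pt 1) a}),
     mor = (\<lambda>X Y f. if topspace X \<noteq> {} then mor F X Y f
                    else if topspace Y = {} then id
                    else mor F (ordinal 1) Y (\<lambda>_. SOME y. y \<in> topspace Y)) \<rparr>"

definition is_base :: "'a topology \<Rightarrow> 'a set set \<Rightarrow> bool" where
  "is_base X \<B> \<longleftrightarrow> (\<forall>V\<in>\<B>. openin X V) \<and>
     (\<forall>U x. openin X U \<and> x \<in> U \<longrightarrow> (\<exists>V\<in>\<B>. x \<in> V \<and> V \<subseteq> U))"

text \<open>
  The weight is a cardinal in the sense of the HOL cardinals library, that is, a well-order, and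
  weights of spaces over different types are compared by \<open>=o\<close>.
\<close>

definition weight :: "'a topology \<Rightarrow> 'a set rel" where
  "weight X = |SOME \<B>. is_base X \<B> \<and> (\<forall>\<C>. is_base X \<C> \<longrightarrow> |\<B>| \<le>o |\<C>| )|"

lemma weight_least_base:
  obtains \<B> where "is_base X \<B>" "weight X = |\<B>|" "\<And>\<C>. is_base X \<C> \<Longrightarrow> weight X \<le>o |\<C>|"
proof -
  let ?P = "\<lambda>\<B>. is_base X \<B> \<and> (\<forall>\<C>. is_base X \<C> \<longrightarrow> |\<B>| \<le>o |\<C>| )"
  have "is_base X {U. openin X U}"
    unfolding is_base_def by blast
  then have "card_of ` Collect (is_base X) \<noteq> {}"
    by blast
  moreover have "\<forall>r\<in>card_of ` Collect (is_base X). Card_order r"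
    by (rule ballI, erule imageE, hypsubst, rule card_of_Card_order)
  ultimately obtain r where r: "r \<in> card_of ` Collect (is_base X)"
      "\<forall>r'\<in>card_of ` Collect (is_base X). r \<le>o r'"
    using exists_minim_Card_order by metis
  from r(1) obtain \<B> where \<B>: "r = |\<B>|" "is_base X \<B>"
    by (elim imageE CollectE)
  have "?P \<B>"
    using \<B>(2) r(2) unfolding \<B>(1) Set.ball_simps by simp
  then have P: "?P (Eps ?P)"
    by (rule someI)
  have w: "weight X = |Eps ?P|"
    by (rule weight_def)
  show ?thesis
    by (rule that[of "Eps ?P"]) (use P in \<open>simp_all only: w\<close>)
qed

definition preserves_weight :: "('a, 'b) functor_data \<Rightarrow> bool" where
  "preserves_weight F \<longleftrightarrow>
     (\<forall>X. compactum X \<and> infinite (topspace X) \<longrightarrow> weight (obj F X) =o weight X)"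

text \<open>
  Naturally isomorphic to a constant functor on the non-empty compacta. Constant functors have
  to be excluded where metrizability of the values on finite spaces is to imply preservation of
  weight: the functor with constant value a singleton is monomorphic and has finite supports, but
  its values have weight 1.
\<close>

definition essentially_constant :: "('a, 'b) functor_data \<Rightarrow> bool" where
  "essentially_constant F \<longleftrightarrow>
     (\<exists>(K :: 'b topology) \<eta>.
        (\<forall>X. compactum X \<and> topspace X \<noteq> {} \<longrightarrow> homeomorphic_map (obj F X) K (\<eta> X)) \<and>
        (\<forall>X Y f. compactum X \<and> topspace X \<noteq> {} \<and> compactum Y \<and> continuous_map X Y f
           \<longrightarrow> (\<forall>a\<in>topspace (obj F X). \<eta> Y (mor F X Y f a) = \<eta> X a)))"

end

theory Submission
  imports Defs
begin

text \<open>
  Write \<open>G\<close> for the maximal modification. A closed set \<open>S \<subseteq> X\<close> carries an element of \<open>G X\<close> if the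
  element comes from \<open>G S\<close>. Finite carriers exist by assumption, and everything rests on the fact
  that the intersection of two finite carriers is a carrier, even if it is empty
  (\<open>carried_Int_finite\<close>). Indeed, let \<open>a\<close> be carried by \<open>S\<close> and by \<open>T\<close>. Retract \<open>S \<union> T\<close> onto \<open>S\<close> so
  that \<open>T\<close> goes into \<open>S \<inter> T\<close>, or to a point if \<open>S\<close> and \<open>T\<close> are disjoint. The retraction fixes \<open>a\<close>
  because \<open>a\<close> comes from \<open>S\<close>; because \<open>a\<close> also comes from \<open>T\<close>, it follows that \<open>a\<close> comes from the
  image of \<open>T\<close>. In the disjoint case \<open>a\<close> thus comes from some \<open>c\<close> in \<open>G 1\<close>, and the map
  \<open>S \<union> T \<rightarrow> 2\<close> that separates \<open>S\<close> from \<open>T\<close> shows that both maps \<open>1 \<rightarrow> 2\<close> send \<open>c\<close> to the same element.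
  The maximal modification has all such \<open>c\<close> as elements over the empty space. Hence every element
  has a least closed carrier, its support, which is finite and possibly empty.

  An intersection of closed sets carries an element iff it contains the support, so intersections
  are preserved. Surjections are preserved because finite maps lift through them. For an inverse
  spectrum with limit \<open>L\<close>, two elements of \<open>G L\<close> are separated by a projection that is injective on
  the union of their supports. Given a thread \<open>(a\<^sub>i)\<close>, the support of \<open>a\<^sub>i\<close> lies in the images of
  all later spaces, hence in the image of \<open>L\<close>; so the preimages of the \<open>a\<^sub>i\<close> in \<open>G L\<close> are non-empty
  closed sets, directed by inclusion, and by compactness they have a common point (\<open>is_continuous\<close>).

  The upper bound for the weight comes from the joint continuity of \<open>(f, c) \<mapsto> G f c\<close>, where \<open>f\<close> ranges
  over the maps \<open>n \<rightarrow> X\<close> and \<open>c\<close> over \<open>G n\<close> (\<open>joint_continuity\<close>). It yields a network of \<open>G X\<close> indexed by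
  a number \<open>n\<close>, a list of \<open>n\<close> sets of a base of \<open>X\<close> and a member of a countable network of the
  metrizable compactum \<open>G n\<close>; and a compactum with a network of an infinite cardinality has a base
  of that cardinality (\<open>weight_le_network\<close>). For the lower bound, either all supports are empty, and
  then the functor is essentially constant, or there is an element \<open>c\<close> with a non-empty support \<open>S\<close>.
  In that case embed \<open>S\<close> in \<open>X\<close> and let one of its points run through \<open>X\<close>. The corresponding
  images of \<open>c\<close> define a map \<open>X \<rightarrow> G X\<close> that is injective off a finite set, as the supports tell the
  images apart; so a base of \<open>G X\<close> yields a network of \<open>X\<close>. Conversely, if weights are preserved, then
  the value at a convergent sequence is metrizable, and the values at finite spaces embed in it.
\<close>

section \<open>Compact Hausdorff spaces\<close>

lemma compactum_closed_subspace: "compactum X \<Longrightarrow> closedin X S \<Longrightarrow> compactum (subtopology X S)"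
  unfolding compactum_def
  by (simp add: closedin_compact_space compact_space_subtopology Hausdorff_space_subtopology)

lemma compactum_finite_discrete: "finite A \<Longrightarrow> compactum (discrete_topology A)"
  unfolding compactum_def by (simp add: compact_space_discrete_topology)

lemma closedin_finite: "compactum X \<Longrightarrow> finite S \<Longrightarrow> S \<subseteq> topspace X \<Longrightarrow> closedin X S"
  unfolding compactum_def by (metis compactin_imp_closedin finite_imp_compactin)

lemma finite_subspace_discrete:
  assumes "compactum X" "finite S" "S \<subseteq> topspace X"
  shows "subtopology X S = discrete_topology S"
proof (rule finite_topspace_imp_discrete_topology)
  show "topspace (subtopology X S) = S"
    using assms(3) by auto
  show "Hausdorff_space (subtopology X S)"
    using assms(1) unfolding compactum_def by (simp add: Hausdorff_space_subtopology)
qed (rule assms(2))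

lemma continuous_map_discrete_domain:
  "continuous_map (discrete_topology A) X f \<longleftrightarrow> f ` A \<subseteq> topspace X"
  unfolding continuous_map_def by auto

lemma closedin_continuous_image:
  assumes "compactum X" "compactum Y" "continuous_map X Y f" "closedin X S"
  shows "closedin Y (f ` S)"
  using assms unfolding compactum_def
  by (metis closedin_compact_space compactin_imp_closedin image_compactin)

text \<open>
  Normality, in the form in which it is used below.
\<close>

lemma compactum_shrink:
  assumes X: "compactum X" and SU: "closedin X S" "openin X U" "S \<subseteq> U"
  obtains P where "openin X P" "S \<subseteq> P" "X closure_of P \<subseteq> U"
proof -
  have "normal_space X"
    using X compact_Hausdorff_or_regular_imp_normal_space unfolding compactum_def by blast
  from this[unfolded normal_space_alt, rule_format, OF conjI[OF SU(1) conjI[OF SU(2,3)]]]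
  show ?thesis
    using that by (elim exE conjE)
qed

lemma open_minus_point:
  assumes "compactum X" "z \<in> topspace X"
  shows "openin X (topspace X - {z})"
  using closedin_finite[of X "{z}"] assms by (intro openin_diff) simp_all

lemma finite_disjoint_open_neighbourhoods:
  assumes X: "Hausdorff_space X" and S: "finite S" "S \<subseteq> topspace X"
  obtains V where "\<And>s. s \<in> S \<Longrightarrow> openin X (V s)" "\<And>s. s \<in> S \<Longrightarrow> s \<in> V s"
    "\<And>s t. s \<in> S \<Longrightarrow> t \<in> S \<Longrightarrow> s \<noteq> t \<Longrightarrow> V s \<inter> V t = {}"
proof -
  define D where "D = {st \<in> S \<times> S. fst st \<noteq> snd st}"
  have "\<forall>st\<in>D. \<exists>u. openin X (fst u) \<and> openin X (snd u) \<and> fst st \<in> fst u \<and> snd st \<in> snd u \<and> fst u \<inter> snd u = {}"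
  proof
    fix st assume "st \<in> D"
    then have "fst st \<in> topspace X" "snd st \<in> topspace X" "fst st \<noteq> snd st"
      using S(2) unfolding D_def by auto
    with X obtain U V where "openin X U" "openin X V" "fst st \<in> U" "snd st \<in> V" "disjnt U V"
      unfolding Hausdorff_space_def by metis
    then show "\<exists>u. openin X (fst u) \<and> openin X (snd u) \<and> fst st \<in> fst u \<and> snd st \<in> snd u \<and> fst u \<inter> snd u = {}"
      by (intro exI[of _ "(U, V)"]) (simp add: disjnt_def)
  qed
  from bchoice[OF this] obtain u where u: "\<forall>st\<in>D. openin X (fst (u st)) \<and> openin X (snd (u st)) \<and>
      fst st \<in> fst (u st) \<and> snd st \<in> snd (u st) \<and> fst (u st) \<inter> snd (u st) = {}"
    by (rule exE)
  define V where "V s = topspace X \<inter> \<Inter>((\<lambda>t. fst (u (s, t)) \<inter> snd (u (t, s))) ` (S - {s}))" for s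
  have uD: "openin X (fst (u (s, t)))" "openin X (snd (u (s, t)))" "s \<in> fst (u (s, t))" "t \<in> snd (u (s, t))"
      "fst (u (s, t)) \<inter> snd (u (s, t)) = {}" if "s \<in> S" "t \<in> S" "s \<noteq> t" for s t
    using bspec[OF u, of "(s, t)"] that by (simp_all add: D_def)
  show ?thesis
  proof (rule that[of V])
    fix s assume s: "s \<in> S"
    show "openin X (V s)"
    proof (cases "S - {s} = {}")
      case True
      then show ?thesis
        unfolding V_def by (simp only: image_empty Inter_empty Int_UNIV_right openin_topspace)
    next
      case False
      have "openin X (fst (u (s, t)) \<inter> snd (u (t, s)))" if "t \<in> S - {s}" for t
        using that s uD(1)[of s t] uD(2)[of t s] by (intro openin_Int) auto
      then have "openin X (\<Inter>((\<lambda>t. fst (u (s, t)) \<inter> snd (u (t, s))) ` (S - {s})))"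
        using False S(1) by (intro openin_Inter) auto
      then show ?thesis
        unfolding V_def by (intro openin_Int openin_topspace)
    qed
    have "s \<in> fst (u (s, t)) \<inter> snd (u (t, s))" if "t \<in> S - {s}" for t
      using that s uD(3)[of s t] uD(4)[of t s] by auto
    then show "s \<in> V s"
      unfolding V_def using s S(2) by (intro IntI INT_I) blast+
    fix t assume t: "t \<in> S" "s \<noteq> t"
    have "V s \<subseteq> fst (u (s, t))" "V t \<subseteq> snd (u (s, t))"
      unfolding V_def using s t by blast+
    then show "V s \<inter> V t = {}"
      using uD(5)[OF s t] by blast
  qed
qed

text \<open>
  The form of compactness behind all limit arguments below: the indices need not be ordered, it is
  enough that the closed sets are directed downwards.
\<close>

lemma compact_directed_Inter_nonempty:
  assumes Z: "compact_space Z" and J: "J \<noteq> {}"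
    and C: "\<And>j. j \<in> J \<Longrightarrow> closedin Z (C j)" "\<And>j. j \<in> J \<Longrightarrow> C j \<noteq> {}"
    and dir: "\<And>j k. j \<in> J \<Longrightarrow> k \<in> J \<Longrightarrow> \<exists>l\<in>J. C l \<subseteq> C j \<inter> C k"
  shows "\<exists>z\<in>topspace Z. \<forall>j\<in>J. z \<in> C j"
proof -
  have low: "\<exists>l\<in>J. C l \<subseteq> \<Inter>(C ` K)" if "finite K" "K \<subseteq> J" for K
    using that
  proof (induction K rule: finite_induct)
    case empty
    then show ?case
      using J by auto
  next
    case (insert j K)
    then obtain l where l: "l \<in> J" "C l \<subseteq> \<Inter>(C ` K)"
      by blast
    obtain m where "m \<in> J" "C m \<subseteq> C j \<inter> C l"
      using dir[of j l] insert.prems l(1) by blast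
    with l(2) show ?case
      by auto
  qed
  have fip: "\<Inter>(C ` K) \<noteq> {}" if K: "finite K" "K \<subseteq> J" for K
  proof -
    obtain l where "l \<in> J" "C l \<subseteq> \<Inter>(C ` K)"
      using low[OF K] by blast
    with C(2)[of l] show ?thesis
      by blast
  qed
  have "\<Inter>(C ` J) \<noteq> {}"
  proof (rule compact_space_fip[THEN iffD1, OF Z, rule_format], intro conjI ballI allI impI)
    fix c assume "c \<in> C ` J"
    then show "closedin Z c"
      using C(1) by blast
  next
    fix \<F> assume "finite \<F> \<and> \<F> \<subseteq> C ` J"
    then obtain K where K: "K \<subseteq> J" "finite K" "\<F> = C ` K"
      using finite_subset_image[of \<F> C J] by blast
    show "\<Inter>\<F> \<noteq> {}"
      unfolding K(3) by (rule fip[OF K(2,1)])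
  qed
  then obtain z where z: "\<forall>j\<in>J. z \<in> C j"
    by blast
  obtain j where j: "j \<in> J"
    using J by blast
  have "z \<in> topspace Z"
    using closedin_subset[OF C(1)[OF j]] z j by blast
  with z show ?thesis
    by blast
qed

lemma continuous_map_constant: "y \<in> topspace Y \<Longrightarrow> continuous_map X Y (\<lambda>_. y)"
  by simp

lemma continuous_map_nonempty: "continuous_map X Y f \<Longrightarrow> topspace X \<noteq> {} \<Longrightarrow> topspace Y \<noteq> {}"
  unfolding continuous_map_def by blast

lemma compactum_ordinal: "compactum (ordinal n)"
  unfolding ordinal_def by (intro compactum_finite_discrete) simp

lemma topspace_ordinal: "topspace (ordinal n) = ord_pt ` {..<n}"
  by (simp add: ordinal_def)

lemma continuous_map_ordinal: "continuous_map (ordinal n) X f \<longleftrightarrow> (\<forall>i<n. f (ord_pt i) \<in> topspace X)"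
  unfolding ordinal_def continuous_map_discrete_domain by auto

lemma topspace_ordinal_1: "topspace (ordinal 1) = {ord_pt 0}"
  by (auto simp: topspace_ordinal)

lemma ordinal_1_nonempty: "topspace (ordinal 1) \<noteq> {}"
  unfolding topspace_ordinal_1 by simp

section \<open>Networks and weight\<close>

lemma card_of_lists_le:
  assumes K: "infinite K" and S: "|S| \<le>o |K|"
  shows "|lists S| \<le>o |K|"
proof -
  define L where "L n = {xs \<in> lists S. length xs = n}" for n
  have "|L n| \<le>o |K|" for n
  proof (induction n)
    case 0
    have "L 0 = {[]}"
      by (auto simp: L_def)
    then show ?case
      using K by (simp add: card_of_singl_ordLeq infinite_imp_nonempty)
  next
    case (Suc n)
    have "L (Suc n) = (\<lambda>(x, xs). x # xs) ` (SIGMA x : S. L n)"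
      by (auto simp: L_def length_Suc_conv image_iff)
    then have "|L (Suc n)| \<le>o |SIGMA x : S. L n|"
      by (simp add: card_of_image)
    also have "|SIGMA x : S. L n| \<le>o |K|"
      using K S Suc by (intro card_of_Sigma_ordLeq_infinite) auto
    finally show ?case .
  qed
  moreover have "lists S = (\<Union>n. L n)"
    by (auto simp: L_def)
  moreover have "|UNIV :: nat set| \<le>o |K|"
    using K infinite_iff_card_of_nat by blast
  ultimately show ?thesis
    using card_of_UNION_ordLeq_infinite[OF K, of UNIV L] by simp
qed

lemma card_of_finite_subsets_le:
  assumes "infinite K" and "|S| \<le>o |K|"
  shows "|{T. finite T \<and> T \<subseteq> S}| \<le>o |K|"
proof -
  have "{T. finite T \<and> T \<subseteq> S} \<subseteq> set ` lists S"
  proof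
    fix T assume "T \<in> {T. finite T \<and> T \<subseteq> S}"
    moreover from this obtain xs where "set xs = T"
      using finite_list by blast
    ultimately show "T \<in> set ` lists S"
      by (auto simp: lists_eq_set)
  qed
  then have "|{T. finite T \<and> T \<subseteq> S}| \<le>o |lists S|"
    by (meson card_of_image card_of_mono1 ordLeq_transitive)
  then show ?thesis
    using card_of_lists_le[OF assms] ordLeq_transitive by blast
qed

lemma countable_card_le:
  assumes "countable A" "infinite K"
  shows "|A| \<le>o |K|"
proof -
  have "|A| \<le>o |UNIV :: nat set|"
    using inj_on_to_nat_on[OF assms(1)] card_of_ordLeq by blast
  then show ?thesis
    using assms(2) infinite_iff_card_of_nat ordLeq_transitive by blast
qed

text \<open>
  A base whose members need not be open. Unlike bases, networks are transported by arbitrary images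
  and can be completed by single points.
\<close>

definition network :: "'a topology \<Rightarrow> 'a set set \<Rightarrow> bool" where
  "network X \<N> \<longleftrightarrow> (\<forall>U x. openin X U \<and> x \<in> U \<longrightarrow> (\<exists>P\<in>\<N>. x \<in> P \<and> P \<subseteq> U))"

lemma networkD: "network X \<N> \<Longrightarrow> openin X U \<Longrightarrow> x \<in> U \<Longrightarrow> \<exists>P\<in>\<N>. x \<in> P \<and> P \<subseteq> U"
  unfolding network_def by blast

lemma base_imp_network: "is_base X \<B> \<Longrightarrow> network X \<B>"
  unfolding is_base_def network_def by blast

text \<open>
  In a Hausdorff space a point is determined by the members of the network that contain it.
\<close>

lemma infinite_network:
  assumes "Hausdorff_space X" and "infinite (topspace X)" and "network X \<N>"
  shows "infinite \<N>"
proof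
  assume fin: "finite \<N>"
  have "inj_on (\<lambda>x. {P \<in> \<N>. x \<in> P}) (topspace X)"
  proof (rule inj_onI, rule ccontr)
    fix x y assume xy: "x \<in> topspace X" "y \<in> topspace X" and
      eq: "{P \<in> \<N>. x \<in> P} = {P \<in> \<N>. y \<in> P}" and ne: "x \<noteq> y"
    obtain U V where "openin X U" "openin X V" "x \<in> U" "y \<in> V" "disjnt U V"
      using assms(1) xy ne unfolding Hausdorff_space_def by metis
    moreover from this obtain P where "P \<in> \<N>" "x \<in> P" "P \<subseteq> U"
      using networkD[OF assms(3)] by blast
    ultimately show False
      using eq unfolding disjnt_def by blast
  qed
  moreover have "finite ((\<lambda>x. {P \<in> \<N>. x \<in> P}) ` topspace X)"
    by (rule finite_subset[of _ "Pow \<N>"]) (use fin in auto)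
  ultimately show False
    using assms(2) finite_imageD by blast
qed

text \<open>
  Choose disjoint open sets around each pair of network members that can be separated in this way.
  The first components of the choices separate points from points, and by compactness finite
  intersections of them separate points from closed sets. So these finite intersections form a
  base, of no larger cardinality than the network.
\<close>

lemma weight_le_network:
  assumes X: "compactum X" and N: "network X \<N>" and K: "infinite K" "|\<N>| \<le>o |K|"
  shows "weight X \<le>o |K|"
proof -
  have cX: "compact_space X" and hX: "Hausdorff_space X"
    using X by (auto simp: compactum_def)
  define sep where "sep = (\<lambda>(P, Q) (U, V). openin X U \<and> openin X V \<and> disjnt U V \<and> P \<subseteq> U \<and> Q \<subseteq> V)"
  define s where "s PQ = (SOME UV. sep PQ UV)" for PQ
  define \<P> where "\<P> = {PQ \<in> \<N> \<times> \<N>. \<exists>UV. sep PQ UV}"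
  have s: "sep PQ (s PQ)" if "PQ \<in> \<P>" for PQ
    using that someI_ex[of "sep PQ"] unfolding s_def \<P>_def by blast
  define \<S> where "\<S> = (fst \<circ> s) ` \<P>"
  have open_S: "openin X U" if "U \<in> \<S>" for U
    using that s unfolding \<S>_def sep_def by (auto simp: case_prod_beta)
  define \<B> where "\<B> = (\<lambda>\<F>. topspace X \<inter> \<Inter>\<F>) ` {\<F>. finite \<F> \<and> \<F> \<subseteq> \<S>}"
  have "|\<N> \<times> \<N>| \<le>o |K|"
    using K card_of_Sigma_ordLeq_infinite[of K \<N> "\<lambda>_. \<N>"] by blast
  then have "|\<P>| \<le>o |K|"
    using ordLeq_transitive[OF card_of_mono1[of \<P> "\<N> \<times> \<N>"]] unfolding \<P>_def by blast
  then have "|\<S>| \<le>o |K|"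
    unfolding \<S>_def using card_of_image ordLeq_transitive by blast
  then have "|{\<F>. finite \<F> \<and> \<F> \<subseteq> \<S>}| \<le>o |K|"
    by (rule card_of_finite_subsets_le[OF K(1)])
  then have card: "|\<B>| \<le>o |K|"
    unfolding \<B>_def using card_of_image ordLeq_transitive by blast
  have "is_base X \<B>"
    unfolding is_base_def
  proof (intro conjI ballI allI impI)
    fix V assume "V \<in> \<B>"
    then obtain \<F> where "finite \<F>" "\<F> \<subseteq> \<S>" and V: "V = topspace X \<inter> \<Inter>\<F>"
      by (auto simp: \<B>_def)
    then have F: "\<forall>U\<in>\<F>. openin X U"
      using open_S by blast
    show "openin X V"
    proof (cases "\<F> = {}")
      case True
      then show ?thesis
        by (simp add: V)
    next
      case False
      then have "openin X (\<Inter>\<F>)"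
        using F \<open>finite \<F>\<close> by (intro openin_Inter) auto
      then show ?thesis
        unfolding V by (intro openin_Int openin_topspace)
    qed
  next
    fix O' x assume "openin X O' \<and> x \<in> O'"
    then have O': "openin X O'" and x: "x \<in> O'" "x \<in> topspace X"
      using openin_subset by auto
    have "\<exists>PQ\<in>\<P>. x \<in> fst (s PQ) \<and> y \<in> snd (s PQ)" if y: "y \<in> topspace X - O'" for y
    proof -
      obtain U V where UV: "openin X U" "openin X V" "x \<in> U" "y \<in> V" "disjnt U V"
        using hX x y unfolding Hausdorff_space_def by (metis DiffD1 DiffD2)
      obtain P where P: "P \<in> \<N>" "x \<in> P" "P \<subseteq> U"
        using networkD[OF N UV(1,3)] by blast
      obtain Q where Q: "Q \<in> \<N>" "y \<in> Q" "Q \<subseteq> V"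
        using networkD[OF N UV(2,4)] by blast
      have "(P, Q) \<in> \<P>"
        unfolding \<P>_def sep_def using P Q UV by auto
      with s[OF this] P Q show ?thesis
        unfolding sep_def by (intro bexI[of _ "(P, Q)"]) (auto simp: case_prod_beta)
    qed
    then obtain c where "\<forall>y\<in>topspace X - O'. c y \<in> \<P> \<and> x \<in> fst (s (c y)) \<and> y \<in> snd (s (c y))"
      using bchoice[of "topspace X - O'" "\<lambda>y PQ. PQ \<in> \<P> \<and> x \<in> fst (s PQ) \<and> y \<in> snd (s PQ)"] by blast
    then have c: "c y \<in> \<P>" "x \<in> fst (s (c y))" "y \<in> snd (s (c y))" if "y \<in> topspace X - O'" for y
      using that by blast+
    have "compactin X (topspace X - O')"
      using cX O' by (simp add: closedin_compact_space closedin_diff)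
    moreover have "openin X (snd (s (c y)))" if "y \<in> topspace X - O'" for y
      using s[OF c(1)[OF that]] by (simp add: sep_def case_prod_beta)
    moreover have "topspace X - O' \<subseteq> \<Union>((\<lambda>y. snd (s (c y))) ` (topspace X - O'))"
      using c(3) by blast
    ultimately have "\<exists>\<F>. finite \<F> \<and> \<F> \<subseteq> (\<lambda>y. snd (s (c y))) ` (topspace X - O') \<and> topspace X - O' \<subseteq> \<Union>\<F>"
      by (intro compactinD) auto
    then obtain \<F> where F: "finite \<F>" "\<F> \<subseteq> (\<lambda>y. snd (s (c y))) ` (topspace X - O')"
        "topspace X - O' \<subseteq> \<Union>\<F>"
      by blast
    then obtain Y where Y: "finite Y" "Y \<subseteq> topspace X - O'" "\<F> = (\<lambda>y. snd (s (c y))) ` Y"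
      using finite_subset_image[OF F(1,2)] by blast
    let ?V = "topspace X \<inter> \<Inter>((\<lambda>y. fst (s (c y))) ` Y)"
    have "?V \<in> \<B>"
    proof -
      have "c y \<in> \<P>" if "y \<in> Y" for y
        using c(1) Y(2) that by blast
      then have "(\<lambda>y. fst (s (c y))) ` Y \<subseteq> \<S>"
        unfolding \<S>_def by auto
      then show ?thesis
        unfolding \<B>_def using Y(1) by (intro image_eqI[OF refl]) simp
    qed
    moreover have "x \<in> ?V"
      using x(2) Y(2) c(2) by blast
    moreover have "?V \<subseteq> O'"
    proof
      fix z assume z: "z \<in> ?V"
      show "z \<in> O'"
      proof (rule ccontr)
        assume "z \<notin> O'"
        with z have "z \<in> \<Union>\<F>"
          using F(3) by blast
        then obtain y where y: "y \<in> Y" "z \<in> snd (s (c y))"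
          unfolding Y(3) by blast
        moreover have "z \<in> fst (s (c y))"
          using z y by auto
        moreover have "disjnt (fst (s (c y))) (snd (s (c y)))"
        proof -
          have "y \<in> topspace X - O'"
            using y(1) Y(2) by blast
          from s[OF c(1)[OF this]] show ?thesis
            by (simp add: sep_def case_prod_beta)
        qed
        ultimately show False
          by (auto simp: disjnt_iff)
      qed
    qed
    ultimately show "\<exists>V\<in>\<B>. x \<in> V \<and> V \<subseteq> O'"
      by blast
  qed
  with card show ?thesis
    using weight_least_base ordLeq_transitive by metis
qed

text \<open>
  Total boundedness provides finitely many balls of radius \<open>1/n\<close> that cover the space.
\<close>

lemma metrizable_countable_network:
  assumes "compact_space X" and "metrizable_space X"
  obtains \<N> where "countable \<N>" "network X \<N>"
proof -
  obtain M d where M: "Metric_space M d" and X: "X = Metric_space.mtopology M d"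
    using assms(2) unfolding metrizable_space_def by blast
  interpret Metric_space M d by (rule M)
  have "mtotally_bounded M"
    using assms(1) compactin_imp_mtotally_bounded[of M] by (simp add: X compact_space_def)
  then have "\<exists>K. finite K \<and> K \<subseteq> M \<and> M \<subseteq> (\<Union>x\<in>K. mball x (1 / real (Suc n)))" for n
    unfolding mtotally_bounded_def by simp
  then obtain K where K: "finite (K n)" "K n \<subseteq> M" "M \<subseteq> (\<Union>x\<in>K n. mball x (1 / real (Suc n)))" for n
    by metis
  define \<N> where "\<N> = (\<Union>n. (\<lambda>x. mball x (1 / real (Suc n))) ` K n)"
  show ?thesis
  proof
    show "countable \<N>"
      unfolding \<N>_def using K(1) by (auto intro: countable_finite)
    show "network X \<N>"
      unfolding network_def X
    proof (intro allI impI, elim conjE)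
      fix U x assume U: "openin mtopology U" "x \<in> U"
      then obtain r where r: "r > 0" "mball x r \<subseteq> U" and x: "x \<in> M"
        unfolding openin_mtopology by blast
      obtain n where n: "1 / real (Suc n) < r / 2"
        using r(1) by (metis half_gt_zero nat_approx_posE)
      obtain z where z: "z \<in> K n" "x \<in> mball z (1 / real (Suc n))"
        using K(3)[of n] x by blast
      have "mball z (1 / real (Suc n)) \<subseteq> mball x r"
        using z n r(1) x triangle[of x z] commute[of x z] by fastforce
      with z r(2) show "\<exists>P\<in>\<N>. x \<in> P \<and> P \<subseteq> U"
        unfolding \<N>_def by blast
    qed
  qed
qed

text \<open>
  Urysohn's argument: for each pair of basic open sets that some continuous function separates,
  choose such a function. These countably many functions embed the space into a product of lines.
\<close>

lemma second_countable_imp_metrizable: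
  assumes X: "compactum X" and sc: "second_countable X"
  shows "metrizable_space X"
proof -
  have cX: "compact_space X" and hX: "Hausdorff_space X"
    using X by (auto simp: compactum_def)
  then have nX: "normal_space X"
    using compact_Hausdorff_or_regular_imp_normal_space by blast
  obtain \<B> where B: "countable \<B>" "\<And>V. V \<in> \<B> \<Longrightarrow> openin X V"
      "\<And>U x. openin X U \<Longrightarrow> x \<in> U \<Longrightarrow> \<exists>V\<in>\<B>. x \<in> V \<and> V \<subseteq> U"
    using sc unfolding second_countable_def by metis
  define sep where "sep = (\<lambda>(U, V) f. continuous_map X euclideanreal f \<and> f ` U \<subseteq> {0} \<and> f ` V \<subseteq> {1})"
  define s where "s UV = (SOME f. sep UV f)" for UV
  define \<P> where "\<P> = {UV \<in> \<B> \<times> \<B>. \<exists>f. sep UV f}"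
  have s: "sep UV (s UV)" if "UV \<in> \<P>" for UV
    using that someI_ex[of "sep UV"] unfolding s_def \<P>_def by blast
  let ?E = "product_topology (\<lambda>_. euclideanreal) \<P>"
  have mE: "metrizable_space ?E"
  proof -
    have "countable \<P>"
      using B(1) by (auto simp: \<P>_def intro: countable_subset[of _ "\<B> \<times> \<B>"])
    then show ?thesis
      unfolding metrizable_space_product_topology
      by (auto simp: metrizable_space_euclidean intro: countable_subset[of _ \<P>])
  qed
  let ?e = "\<lambda>x. \<lambda>UV\<in>\<P>. s UV x"
  have cont: "continuous_map X ?E ?e"
    using s by (auto simp: continuous_map_componentwise sep_def case_prod_beta)
  have "inj_on ?e (topspace X)"
  proof (rule inj_onI, rule ccontr)
    fix x y assume xy: "x \<in> topspace X" "y \<in> topspace X" "?e x = ?e y" "x \<noteq> y"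
    have "closedin X {x}" "closedin X {y}"
      using xy hX by (auto simp: closedin_Hausdorff_sing_eq)
    then obtain g where g: "continuous_map X euclideanreal g" "g x = 0" "g y = 1"
      using nX xy(4) Urysohn_lemma_alt[of X "{x}" "{y}" 0 1] by auto
    have op: "openin X {z \<in> topspace X. g z < 1/3}" "openin X {z \<in> topspace X. g z > 2/3}"
      using openin_continuous_map_preimage[OF g(1), of "{..<1/3}"]
        openin_continuous_map_preimage[OF g(1), of "{2/3<..}"] by auto
    obtain U where U: "U \<in> \<B>" "x \<in> U" "U \<subseteq> {z \<in> topspace X. g z < 1/3}"
      using B(3)[OF op(1), of x] xy g by auto
    obtain V where V: "V \<in> \<B>" "y \<in> V" "V \<subseteq> {z \<in> topspace X. g z > 2/3}"
      using B(3)[OF op(2), of y] xy g by auto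
    \<comment> \<open>Rescaling makes the values constant below \<open>1/3\<close> and above \<open>2/3\<close>.\<close>
    have "sep (U, V) (\<lambda>z. min 1 (max 0 (3 * g z - 1)))"
      using U V g(1) unfolding sep_def
      by (fastforce intro!: continuous_intros)
    then have P: "(U, V) \<in> \<P>"
      using U V by (auto simp: \<P>_def)
    have "s (U, V) x = 0" "s (U, V) y = 1"
      using s[OF P] U V by (auto simp: sep_def)
    with fun_cong[OF xy(3), of "(U, V)"] P show False
      by simp
  qed
  then have "embedding_map X ?E ?e"
    using cont cX by (intro continuous_imp_embedding_map)
      (auto simp: Hausdorff_space_product_topology Hausdorff_space_euclidean)
  then have "X homeomorphic_space subtopology ?E (?e ` topspace X)"
    by (rule embedding_map_imp_homeomorphic_space)
  then show ?thesis
    using homeomorphic_metrizable_space metrizable_space_subtopology[OF mE] by blast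
qed

lemma second_countable_of_weight_eq:
  assumes "second_countable X" and "weight Y =o weight X"
  shows "second_countable Y"
proof -
  obtain \<B> where "countable \<B>" "is_base X \<B>"
    using assms(1) unfolding second_countable_def is_base_def by (elim exE conjE) simp
  obtain \<C> where C: "is_base Y \<C>" "weight Y = |\<C>|"
    using weight_least_base by metis
  have "weight X \<le>o |\<B>|"
    using weight_least_base \<open>is_base X \<B>\<close> by metis
  then have "|\<C>| \<le>o |\<B>|"
    using ordIso_ordLeq_trans[OF assms(2)] C(2) by simp
  moreover have "|\<B>| \<le>o |UNIV :: nat set|"
    by (rule countable_card_le[OF \<open>countable \<B>\<close> infinite_UNIV_nat])
  ultimately have "|\<C>| \<le>o |UNIV :: nat set|"
    by (rule ordLeq_transitive)
  then have "countable \<C>"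
    unfolding countable_def using card_of_ordLeq[of \<C> "UNIV :: nat set"] by blast
  then show ?thesis
    using C(1) unfolding second_countable_def is_base_def by (intro exI[of _ \<C>] conjI) simp_all
qed

text \<open>
  The convergent sequence \<open>0, 1, 1/2, 1/3, \<dots>\<close>, transported to \<open>'a\<close> along an injection.
\<close>

lemma infinite_second_countable_compactum:
  obtains X :: "'a::infinite topology"
  where "compactum X" "infinite (topspace X)" "second_countable X"
proof -
  define K :: "real set" where "K = insert 0 (range (\<lambda>n. 1 / real (Suc n)))"
  have K: "compact K"
    unfolding K_def by (rule compact_sequence_with_limit) (rule LIMSEQ_inverse_real_of_nat[unfolded inverse_eq_divide])
  have "inj (\<lambda>n. 1 / real (Suc n))"
    by (auto simp: inj_def)
  then have "infinite K"
    unfolding K_def by (simp add: finite_image_iff)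
  have "countable K"
    unfolding K_def by simp
  define g :: "real \<Rightarrow> 'a" where "g = ord_pt \<circ> to_nat_on K"
  have g: "inj_on g K"
    unfolding g_def using \<open>countable K\<close> inj_ord_pt by (metis comp_inj_on inj_on_subset inj_on_to_nat_on subset_UNIV)
  define X where "X = pullback_topology (g ` K) (inv_into K g) (top_of_set K)"
  have tX: "topspace X = g ` K"
    unfolding X_def by (auto simp: topspace_pullback_topology inv_into_into)
  have "homeomorphic_maps X (top_of_set K) (inv_into K g) g"
    unfolding homeomorphic_maps_def
  proof (intro conjI)
    show "continuous_map X (top_of_set K) (inv_into K g)"
      unfolding X_def using continuous_map_pullback[of "top_of_set K" "top_of_set K" id] by simp
    show "continuous_map (top_of_set K) X g"
      unfolding X_def
      by (rule continuous_map_pullback') (use g in \<open>auto simp: o_def intro: continuous_map_eq[OF continuous_map_id]\<close>)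
    show "\<forall>x\<in>topspace X. g (inv_into K g x) = x"
      by (auto simp: tX f_inv_into_f)
    show "\<forall>y\<in>topspace (top_of_set K). inv_into K g (g y) = y"
      using g by auto
  qed
  then have hom: "X homeomorphic_space (top_of_set K)"
    unfolding homeomorphic_space_def by blast
  obtain \<B> :: "real set set" where "countable \<B>" "topological_basis \<B>"
    using ex_countable_basis by blast
  then have "second_countable (euclidean :: real topology)"
    unfolding second_countable_def open_openin[symmetric]
    by (intro exI[of _ \<B>]) (metis topological_basisE topological_basis_open)
  show ?thesis
  proof
    have "compact_space (top_of_set K)"
      by (rule compact_space_subtopology) (rule compactin_euclidean_iff[THEN iffD2, OF K])
    moreover have "Hausdorff_space (top_of_set K)"
      by (intro Hausdorff_space_subtopology Hausdorff_space_euclidean)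
    ultimately show "compactum X"
      unfolding compactum_def
      using homeomorphic_compact_space[OF hom] homeomorphic_Hausdorff_space[OF hom] by blast
    show "infinite (topspace X)"
      using tX \<open>infinite K\<close> g finite_imageD by metis
    show "second_countable X"
      using homeomorphic_space_second_countability[OF hom]
        second_countable_subtopology[OF \<open>second_countable (euclidean :: real topology)\<close>]
      by blast
  qed
qed

section \<open>Functors and carriers of elements\<close>

definition carried :: "('a, 'b) functor_data \<Rightarrow> 'a topology \<Rightarrow> 'a set \<Rightarrow> 'b set" where
  "carried G X S = mor G (subtopology X S) X id ` topspace (obj G (subtopology X S))"

locale compacta_functor =
  fixes G :: "('a::infinite, 'b) functor_data"
  assumes is_functor: "comp_functor G"
begin

lemmas functor_laws = is_functor[unfolded comp_functor_def]

lemma obj_compactum: "compactum X \<Longrightarrow> compactum (obj G X)"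
  by (rule functor_laws[THEN conjunct1, rule_format])

lemma mor_continuous:
  "compactum X \<Longrightarrow> compactum Y \<Longrightarrow> continuous_map X Y f \<Longrightarrow> continuous_map (obj G X) (obj G Y) (mor G X Y f)"
  by (rule functor_laws[THEN conjunct2, THEN conjunct1, rule_format]) simp

lemma mor_in:
  assumes "compactum X" "compactum Y" "continuous_map X Y f" "a \<in> topspace (obj G X)"
  shows "mor G X Y f a \<in> topspace (obj G Y)"
  using mor_continuous[OF assms(1-3)] assms(4) by (auto simp: continuous_map_def)

lemma mor_cong:
  assumes "compactum X" "compactum Y" "continuous_map X Y f" "a \<in> topspace (obj G X)"
    and "\<And>x. x \<in> topspace X \<Longrightarrow> f x = g x"
  shows "mor G X Y f a = mor G X Y g a"
  by (rule functor_laws[THEN conjunct2, THEN conjunct2, THEN conjunct1, rule_format])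
    (use assms in simp_all)

lemma mor_ident:
  assumes "compactum X" "a \<in> topspace (obj G X)" "\<And>x. x \<in> topspace X \<Longrightarrow> f x = x"
  shows "mor G X X f a = a"
proof -
  have "mor G X X id a = mor G X X f a"
    using assms by (intro mor_cong) simp_all
  moreover have "mor G X X id a = a"
    by (rule functor_laws[THEN conjunct2, THEN conjunct2, THEN conjunct2, THEN conjunct1, rule_format])
      (use assms in simp_all)
  ultimately show ?thesis
    by simp
qed

text \<open>Composition in a form that lets the composite be any function with the right values.\<close>

lemma mor_comp:
  assumes "compactum X" "compactum Y" "compactum Z" "continuous_map X Y f" "continuous_map Y Z g"
    and "a \<in> topspace (obj G X)" and "\<And>x. x \<in> topspace X \<Longrightarrow> g (f x) = h x"
  shows "mor G Y Z g (mor G X Y f a) = mor G X Z h a"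
proof -
  have "mor G X Z (g \<circ> f) a = mor G Y Z g (mor G X Y f a)"
    by (rule functor_laws[THEN conjunct2, THEN conjunct2, THEN conjunct2, THEN conjunct2, rule_format])
      (use assms in simp_all)
  moreover have "mor G X Z (g \<circ> f) a = mor G X Z h a"
    using assms by (intro mor_cong continuous_map_compose[of X Y]) auto
  ultimately show ?thesis
    by simp
qed

lemma carried_subset: "compactum X \<Longrightarrow> closedin X S \<Longrightarrow> carried G X S \<subseteq> topspace (obj G X)"
  unfolding carried_def
  by (auto intro!: mor_in compactum_closed_subspace continuous_map_from_subtopology)

lemma closedin_carried: "compactum X \<Longrightarrow> closedin X S \<Longrightarrow> closedin (obj G X) (carried G X S)"
  unfolding carried_def
  by (intro closedin_continuous_image[of "obj G (subtopology X S)"] obj_compactum mor_continuous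
      compactum_closed_subspace continuous_map_from_subtopology closedin_topspace) auto

lemma mor_in_carried:
  assumes "compactum Z" "compactum X" "closedin X S" "continuous_map Z X f" "f ` topspace Z \<subseteq> S"
    and c: "c \<in> topspace (obj G Z)"
  shows "mor G Z X f c \<in> carried G X S"
proof -
  have f: "continuous_map Z (subtopology X S) f"
    using assms by (auto simp: continuous_map_in_subtopology)
  have cS: "compactum (subtopology X S)"
    using assms compactum_closed_subspace by blast
  have "mor G (subtopology X S) X id (mor G Z (subtopology X S) f c) = mor G Z X f c"
    using assms f cS by (intro mor_comp) (auto intro: continuous_map_from_subtopology)
  moreover have "mor G Z (subtopology X S) f c \<in> topspace (obj G (subtopology X S))"
    using assms f cS by (intro mor_in)
  ultimately show ?thesis
    unfolding carried_def by (metis image_eqI)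
qed

lemma mor_carried:
  assumes "compactum X" "compactum Y" "continuous_map X Y f" "closedin X S" "closedin Y T" "f ` S \<subseteq> T"
    and a: "a \<in> carried G X S"
  shows "mor G X Y f a \<in> carried G Y T"
proof -
  obtain c where c: "c \<in> topspace (obj G (subtopology X S))" "a = mor G (subtopology X S) X id c"
    using a unfolding carried_def by blast
  have cS: "compactum (subtopology X S)"
    using assms compactum_closed_subspace by blast
  have "mor G X Y f a = mor G (subtopology X S) Y f c"
    unfolding c(2) using assms c(1) cS by (intro mor_comp) (auto intro: continuous_map_from_subtopology)
  also have "\<dots> \<in> carried G Y T"
    using assms c(1) cS by (intro mor_in_carried) (auto intro: continuous_map_from_subtopology)
  finally show ?thesis .
qed

lemma carried_topspace: "compactum X \<Longrightarrow> carried G X (topspace X) = topspace (obj G X)"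
  unfolding carried_def by (force simp: mor_ident)

lemma carried_mono:
  assumes "compactum X" "closedin X S" "closedin X T" "S \<subseteq> T"
  shows "carried G X S \<subseteq> carried G X T"
proof
  fix a assume a: "a \<in> carried G X S"
  then have "mor G X X id a \<in> carried G X T"
    using assms by (intro mor_carried[of X X id S T]) auto
  moreover have "mor G X X id a = a"
    using a assms carried_subset by (intro mor_ident) auto
  ultimately show "a \<in> carried G X T"
    by simp
qed

lemma carried_finite_iff:
  assumes "compactum X" "finite S" "S \<subseteq> topspace X"
  shows "a \<in> carried G X S \<longleftrightarrow>
    (\<exists>c\<in>topspace (obj G (discrete_topology S)). a = mor G (discrete_topology S) X id c)"
  unfolding carried_def finite_subspace_discrete[OF assms] by blast

end

locale finitely_supported_functor = compacta_functor +
  assumes fin_supp: "finite_supports G"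
begin

lemma finite_carrier:
  assumes X: "compactum X" and a: "a \<in> topspace (obj G X)"
  obtains S where "finite S" "S \<subseteq> topspace X" "a \<in> carried G X S"
proof -
  obtain A f where Af: "finite A" "continuous_map (discrete_topology A) X f"
      "a \<in> mor G (discrete_topology A) X f ` topspace (obj G (discrete_topology A))"
    using fin_supp X a unfolding finite_supports_def by meson
  then have fA: "f ` A \<subseteq> topspace X"
    unfolding continuous_map_discrete_domain by blast
  have cA: "compactum (discrete_topology A)"
    by (rule compactum_finite_discrete[OF Af(1)])
  have "closedin X (f ` A)"
    using X fA Af(1) by (intro closedin_finite finite_imageI)
  then have "a \<in> carried G X (f ` A)"
    using Af(3) mor_in_carried[OF cA X _ Af(2)] by auto
  then show ?thesis
    using fA Af(1) by (intro that[of "f ` A"] finite_imageI)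
qed

text \<open>
  Carriers can be shrunk to finite ones: take a finite carrier inside the subspace.
\<close>

lemma finite_carrier_within:
  assumes X: "compactum X" and T: "closedin X T" and a: "a \<in> carried G X T"
  obtains S where "finite S" "S \<subseteq> T" "a \<in> carried G X S"
proof -
  have TX: "T \<subseteq> topspace X"
    by (rule closedin_subset[OF T])
  have cT: "compactum (subtopology X T)"
    by (rule compactum_closed_subspace[OF X T])
  obtain c where c: "c \<in> topspace (obj G (subtopology X T))" "a = mor G (subtopology X T) X id c"
    using a unfolding carried_def by blast
  obtain S where S: "finite S" "S \<subseteq> T" "c \<in> carried G (subtopology X T) S"
    using finite_carrier[OF cT c(1)] by (metis topspace_subtopology_subset TX)
  have "closedin X S" "closedin (subtopology X T) S"
    using X cT S(1,2) TX by (auto intro!: closedin_finite subset_trans[OF S(2)])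
  then have "a \<in> carried G X S"
    unfolding c(2) using X cT S(3)
    by (intro mor_carried[of _ _ _ S]) (auto intro: continuous_map_from_subtopology)
  then show ?thesis
    by (rule that[OF S(1,2)])
qed

text \<open>
  A map of finite discrete spaces lifts through every surjection, so elements with finite carriers
  lift too.
\<close>

lemma lift_carried:
  assumes "compactum X" "compactum Y" "continuous_map X Y f" "closedin X S" "closedin Y T" "T \<subseteq> f ` S"
    and b: "b \<in> carried G Y T"
  shows "b \<in> mor G X Y f ` carried G X S"
proof -
  obtain A where A: "finite A" "A \<subseteq> T" "b \<in> carried G Y A"
    by (rule finite_carrier_within[OF assms(2,5) b])
  have AY: "A \<subseteq> topspace Y"
    using A(2) closedin_subset[OF assms(5)] by (rule subset_trans)
  obtain c where c: "c \<in> topspace (obj G (discrete_topology A))" "b = mor G (discrete_topology A) Y id c"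
    using A(3) carried_finite_iff[OF assms(2) A(1) AY] by blast
  have "\<forall>y\<in>A. \<exists>x. x \<in> S \<and> f x = y"
    using A(2) assms(6) by blast
  from bchoice[OF this] obtain h where h: "\<forall>y\<in>A. h y \<in> S \<and> f (h y) = y"
    by (rule exE)
  have hX: "continuous_map (discrete_topology A) X h"
    unfolding continuous_map_discrete_domain using h closedin_subset[OF assms(4)] by blast
  have "mor G (discrete_topology A) X h c \<in> carried G X S"
    using assms A c h hX by (intro mor_in_carried) (auto simp: compactum_finite_discrete)
  moreover have "mor G X Y f (mor G (discrete_topology A) X h c) = b"
    unfolding c(2) using assms A c h hX by (intro mor_comp) (auto simp: compactum_finite_discrete)
  ultimately show ?thesis
    by blast
qed

lemma is_epimorphic: "epimorphic G"
  unfolding epimorphic_def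
proof (intro allI impI, elim conjE)
  fix X Y :: "'a topology" and f
  assume *: "compactum X" "compactum Y" "continuous_map X Y f" "f ` topspace X = topspace Y"
  show "mor G X Y f ` topspace (obj G X) = topspace (obj G Y)"
  proof
    show "mor G X Y f ` topspace (obj G X) \<subseteq> topspace (obj G Y)"
      using * mor_in by blast
    show "topspace (obj G Y) \<subseteq> mor G X Y f ` topspace (obj G X)"
      using * lift_carried[of X Y f "topspace X" "topspace Y"] carried_topspace by auto
  qed
qed

text \<open>
  A finite carrier is the image of a finite ordinal, and elements lift along this surjection.
\<close>

lemma from_ordinal:
  assumes X: "compactum X" and a: "a \<in> topspace (obj G X)"
  obtains n f c where "f ` ord_pt ` {..<n} \<subseteq> topspace X" "c \<in> topspace (obj G (ordinal n))"
    "a = mor G (ordinal n) X f c"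
proof -
  obtain S where S: "finite S" "S \<subseteq> topspace X" "a \<in> carried G X S"
    using finite_carrier[OF assms] .
  obtain h0 where h0: "bij_betw h0 {..<card S} S"
    using ex_bij_betw_nat_finite[OF S(1)] unfolding atLeast0LessThan by blast
  define h where "h x = h0 (inv ord_pt x)" for x :: 'a
  have h: "h ` ord_pt ` {..<card S} = S"
    using bij_betw_imp_surj_on[OF h0] by (simp add: h_def image_image inv_f_f[OF inj_ord_pt])
  have cn: "compactum (ordinal (card S))"
    unfolding ordinal_def by (intro compactum_finite_discrete) simp
  have hX: "continuous_map (ordinal (card S)) X h"
    unfolding ordinal_def continuous_map_discrete_domain using h S(2) by simp
  have "a \<in> mor G (ordinal (card S)) X h ` carried G (ordinal (card S)) (topspace (ordinal (card S)))"
    using X cn hX S h by (intro lift_carried[where T = S]) (auto simp: closedin_finite ordinal_def)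
  then obtain c where "c \<in> topspace (obj G (ordinal (card S)))" "a = mor G (ordinal (card S)) X h c"
    using carried_topspace[OF cn] by blast
  moreover have "h ` ord_pt ` {..<card S} \<subseteq> topspace X"
    using h S(2) by simp
  ultimately show ?thesis
    by (intro that[of h "card S" c])
qed

end

section \<open>Supports\<close>

text \<open>
  The property of the maximal modification that is not shared by all monomorphic functors: an
  element over a point on which the two maps \<open>1 \<rightarrow> 2\<close> agree comes from the empty space.
\<close>

locale maximal_functor = finitely_supported_functor +
  assumes mono: "monomorphic G"
    and maximal: "\<And>c. c \<in> topspace (obj G (ordinal 1)) \<Longrightarrow>
      mor G (ordinal 1) (ordinal 2) (\<lambda>_. ord_pt 0) c = mor G (ordinal 1) (ordinal 2) (\<lambda>_. ord_pt 1) c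
      \<Longrightarrow> c \<in> carried G (ordinal 1) {}"
begin

lemma mor_inj:
  assumes "compactum X" "compactum Y" "continuous_map X Y f" "inj_on f (topspace X)"
    and "a \<in> topspace (obj G X)" "b \<in> topspace (obj G X)" "mor G X Y f a = mor G X Y f b"
  shows "a = b"
proof -
  have "inj_on (mor G X Y f) (topspace (obj G X))"
    using mono[unfolded monomorphic_def, rule_format, of X Y f] assms(1-4) by simp
  then show ?thesis
    using assms(5-7) by (simp add: inj_on_eq_iff)
qed

text \<open>
  The element is moved by a retraction \<open>r\<close> of \<open>S \<union> T\<close> onto \<open>S\<close> that maps \<open>T\<close> into \<open>S \<inter> T\<close>. If the
  intersection is empty, \<open>r\<close> is constant on \<open>T\<close> and the maximality of the functor takes over.
\<close>

lemma carried_Int_finite: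
  assumes X: "compactum X" and S: "finite S" "S \<subseteq> topspace X" and T: "finite T" "T \<subseteq> topspace X"
    and aS: "a \<in> carried G X S" and aT: "a \<in> carried G X T"
  shows "a \<in> carried G X (S \<inter> T)"
proof (cases "S = {} \<or> T = {}")
  case True
  then show ?thesis
    using aS aT by auto
next
  case False
  \<comment> \<open>The value of the retraction on \<open>T - S\<close>: in \<open>S \<inter> T\<close> if possible.\<close>
  obtain s0 where s0: "s0 \<in> S" "S \<inter> T \<noteq> {} \<Longrightarrow> s0 \<in> S \<inter> T"
    using False by (cases "S \<inter> T = {}") auto
  let ?S = "discrete_topology S" and ?T = "discrete_topology T" and ?C = "discrete_topology (S \<union> T)"
  have cS: "compactum ?S" and cT: "compactum ?T" and cC: "compactum ?C"
    using S(1) T(1) by (simp_all add: compactum_finite_discrete)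
  have SC: "continuous_map ?S ?C id" and TC: "continuous_map ?T ?C id" and CX: "continuous_map ?C X id"
    using S(2) T(2) by (auto simp: continuous_map_discrete_domain)
  obtain a' where a': "a' \<in> topspace (obj G ?S)" "a = mor G ?S X id a'"
    using aS carried_finite_iff[OF X S] by blast
  obtain b' where b': "b' \<in> topspace (obj G ?T)" "a = mor G ?T X id b'"
    using aT carried_finite_iff[OF X T] by blast
  define e where "e = mor G ?S ?C id a'"
  have e: "e \<in> topspace (obj G ?C)"
    unfolding e_def by (rule mor_in[OF cS cC SC a'(1)])
  have "mor G ?C X id e = a"
    unfolding e_def a'(2) by (rule mor_comp[OF cS cC X SC CX a'(1)]) simp
  moreover have "mor G ?C X id (mor G ?T ?C id b') = a"
    unfolding b'(2) by (rule mor_comp[OF cT cC X TC CX b'(1)]) simp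
  ultimately have e_b: "e = mor G ?T ?C id b'"
    using mor_inj[OF cC X CX _ e mor_in[OF cT cC TC b'(1)]] by simp
  define r where "r x = (if x \<in> S then x else s0)" for x
  have rC: "continuous_map ?C ?S r" and rT: "continuous_map ?T ?S r"
    using s0(1) by (auto simp: continuous_map_discrete_domain r_def)
  have "mor G ?C ?S r e = mor G ?S ?S id a'"
    unfolding e_def by (rule mor_comp[OF cS cC cS SC rC a'(1)]) (simp add: r_def)
  then have "mor G ?C ?S r e = a'"
    using mor_ident[OF cS a'(1), of id] by simp
  moreover have "mor G ?C ?S r e = mor G ?T ?S r b'"
    unfolding e_b by (rule mor_comp[OF cT cC cS TC rC b'(1)]) simp
  ultimately have a'_b: "a' = mor G ?T ?S r b'"
    by simp
  have SX: "continuous_map ?S X id"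
    using S(2) by (auto simp: continuous_map_discrete_domain)
  have a_b: "a = mor G ?T X r b'"
    unfolding a'(2) a'_b by (rule mor_comp[OF cT cS X rT SX b'(1)]) simp
  have rX: "continuous_map ?T X r"
    using s0(1) S(2) T(2) by (auto simp: continuous_map_discrete_domain r_def)
  show ?thesis
  proof (cases "S \<inter> T = {}")
    case False
    then have "r ` topspace ?T \<subseteq> S \<inter> T"
      using s0(2) by (auto simp: r_def)
    moreover have "closedin X (S \<inter> T)"
      using S by (intro closedin_finite[OF X]) auto
    ultimately show ?thesis
      unfolding a_b using mor_in_carried[OF cT X _ rX _ b'(1)] by blast
  next
    case True
    let ?I = "ordinal 1 :: 'a topology" and ?II = "ordinal 2 :: 'a topology"
    let ?p0 = "\<lambda>_ :: 'a. ord_pt 0 :: 'a" and ?p1 = "\<lambda>_ :: 'a. ord_pt 1 :: 'a"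
    define c where "c = mor G ?C ?I ?p0 e"
    have to1: "continuous_map Y ?I ?p0" for Y :: "'a topology"
      by (intro continuous_map_constant) (simp add: topspace_ordinal)
    have to2: "continuous_map Y ?II ?p0" "continuous_map Y ?II ?p1" for Y :: "'a topology"
      by (intro continuous_map_constant; simp add: topspace_ordinal)+
    have c: "c \<in> topspace (obj G ?I)"
      unfolding c_def by (rule mor_in[OF cC compactum_ordinal to1 e])
    have c_S: "c = mor G ?S ?I ?p0 a'"
      unfolding c_def e_def by (rule mor_comp[OF cS cC compactum_ordinal SC to1 a'(1)]) simp
    have c_T: "c = mor G ?T ?I ?p0 b'"
      unfolding c_def e_b by (rule mor_comp[OF cT cC compactum_ordinal TC to1 b'(1)]) simp
    \<comment> \<open>Computing the image of \<open>a\<close> under \<open>\<phi>\<close> on \<open>S\<close> and on \<open>T\<close> gives the two images of \<open>c\<close> in \<open>G 2\<close>.\<close>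
    define \<phi> where "\<phi> x = (if x \<in> S then ord_pt 0 else ord_pt 1 :: 'a)" for x :: 'a
    have \<phi>: "continuous_map ?C ?II \<phi>"
      by (auto simp: continuous_map_discrete_domain \<phi>_def topspace_ordinal)
    have "mor G ?I ?II ?p0 c = mor G ?S ?II ?p0 a'"
      unfolding c_S by (rule mor_comp[OF cS compactum_ordinal compactum_ordinal to1 to2(1) a'(1)]) simp
    also have "\<dots> = mor G ?C ?II \<phi> e"
      unfolding e_def by (rule mor_comp[OF cS cC compactum_ordinal SC \<phi> a'(1), symmetric]) (simp add: \<phi>_def)
    also have "\<dots> = mor G ?T ?II ?p1 b'"
      unfolding e_b by (rule mor_comp[OF cT cC compactum_ordinal TC \<phi> b'(1)]) (use True in \<open>auto simp: \<phi>_def\<close>)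
    also have "\<dots> = mor G ?I ?II ?p1 c"
      unfolding c_T by (rule mor_comp[OF cT compactum_ordinal compactum_ordinal to1 to2(2) b'(1), symmetric]) simp
    finally have "c \<in> carried G ?I {}"
      by (rule maximal[OF c])
    moreover have "continuous_map ?I X (\<lambda>_. s0)"
      using s0(1) S(2) by (intro continuous_map_constant) blast
    ultimately have "mor G ?I X (\<lambda>_. s0) c \<in> carried G X {}"
      using X compactum_ordinal by (intro mor_carried[of ?I X _ "{}"]) simp_all
    moreover have "mor G ?I X (\<lambda>_. s0) c = a"
      unfolding a_b c_T using \<open>continuous_map ?I X (\<lambda>_. s0)\<close>
      by (intro mor_comp[OF cT compactum_ordinal X to1 _ b'(1)]) (use True in \<open>auto simp: r_def\<close>)
    ultimately show ?thesis
      using True by simp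
  qed
qed

definition supp :: "'a topology \<Rightarrow> 'b \<Rightarrow> 'a set" where
  "supp X a = \<Inter>{T. closedin X T \<and> a \<in> carried G X T}"

lemma supp_least: "closedin X T \<Longrightarrow> a \<in> carried G X T \<Longrightarrow> supp X a \<subseteq> T"
  unfolding supp_def by blast

text \<open>
  A finite carrier of least cardinality is contained in every finite carrier, since it cannot
  become smaller when intersected with one; and every closed carrier contains a finite one.
\<close>

lemma
  assumes X: "compactum X" and a: "a \<in> topspace (obj G X)"
  shows finite_supp: "finite (supp X a)" and supp_subset: "supp X a \<subseteq> topspace X"
    and in_carried_supp: "a \<in> carried G X (supp X a)"
proof -
  define P where "P S \<longleftrightarrow> finite S \<and> S \<subseteq> topspace X \<and> a \<in> carried G X S" for S
  have "\<exists>S. P S"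
    using finite_carrier[OF X a] unfolding P_def by metis
  then obtain S where S: "P S" and least: "\<And>T. P T \<Longrightarrow> card S \<le> card T"
    using ex_has_least_nat[of P _ card] by metis
  have SX: "closedin X S"
    using S X unfolding P_def by (simp add: closedin_finite)
  have "S \<subseteq> T" if T: "closedin X T" "a \<in> carried G X T" for T
  proof -
    obtain T' where T': "finite T'" "T' \<subseteq> T" "a \<in> carried G X T'"
      by (rule finite_carrier_within[OF X T])
    have "T' \<subseteq> topspace X"
      using T'(2) closedin_subset[OF T(1)] by (rule subset_trans)
    then have "a \<in> carried G X (S \<inter> T')"
      using S T' X unfolding P_def by (intro carried_Int_finite) simp_all
    then have "P (S \<inter> T')"
      using S unfolding P_def by auto
    then have "S \<inter> T' = S"
      using least[of "S \<inter> T'"] S unfolding P_def by (intro card_seteq) auto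
    then show ?thesis
      using T'(2) by blast
  qed
  then have "S \<subseteq> supp X a"
    unfolding supp_def by blast
  moreover have "supp X a \<subseteq> S"
    using S SX unfolding P_def by (intro supp_least) simp_all
  ultimately have "supp X a = S"
    by (rule subset_antisym[rotated])
  then show "finite (supp X a)" "supp X a \<subseteq> topspace X" "a \<in> carried G X (supp X a)"
    using S unfolding P_def by simp_all
qed

lemma closedin_supp: "compactum X \<Longrightarrow> a \<in> topspace (obj G X) \<Longrightarrow> closedin X (supp X a)"
  by (intro closedin_finite finite_supp supp_subset)

lemma in_carried_iff:
  assumes "compactum X" "closedin X T" "a \<in> topspace (obj G X)"
  shows "a \<in> carried G X T \<longleftrightarrow> supp X a \<subseteq> T"
proof
  show "supp X a \<subseteq> T" if "a \<in> carried G X T"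
    by (rule supp_least[OF assms(2) that])
  show "a \<in> carried G X T" if "supp X a \<subseteq> T"
    using carried_mono[OF assms(1) closedin_supp[OF assms(1,3)] assms(2) that]
      in_carried_supp[OF assms(1,3)] by blast
qed

lemma is_intersection_preserving: "preserves_intersections G"
  unfolding preserves_intersections_def carried_def[symmetric]
proof (intro allI impI, elim conjE)
  fix X :: "'a topology" and \<A>
  assume X: "compactum X" and A: "\<A> \<noteq> {}" "\<forall>A\<in>\<A>. closedin X A"
  have cl: "closedin X (\<Inter>\<A>)"
    using A by (intro closedin_Inter) auto
  obtain A0 where A0: "A0 \<in> \<A>"
    using A(1) by blast
  show "carried G X (\<Inter>\<A>) = (\<Inter>A\<in>\<A>. carried G X A)"
  proof (intro equalityI subsetI INT_I)
    fix a A assume "a \<in> carried G X (\<Inter>\<A>)" "A \<in> \<A>"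
    then show "a \<in> carried G X A"
      using carried_mono[OF X cl, of A] A(2) by blast
  next
    fix a assume a: "a \<in> (\<Inter>A\<in>\<A>. carried G X A)"
    then have aX: "a \<in> topspace (obj G X)"
      using A0 A(2) carried_subset[OF X] by blast
    have "supp X a \<subseteq> A" if "A \<in> \<A>" for A
      using that a A(2) by (intro supp_least) auto
    then show "a \<in> carried G X (\<Inter>\<A>)"
      using in_carried_iff[OF X cl aX] by blast
  qed
qed

lemma supp_mor_subset:
  assumes "compactum X" "compactum Y" "continuous_map X Y f" "a \<in> topspace (obj G X)"
  shows "supp Y (mor G X Y f a) \<subseteq> f ` supp X a"
proof (rule supp_least)
  show cl: "closedin Y (f ` supp X a)"
    by (rule closedin_continuous_image[OF assms(1-3) closedin_supp[OF assms(1,4)]])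
  show "mor G X Y f a \<in> carried G Y (f ` supp X a)"
    by (rule mor_carried[OF assms(1-3) closedin_supp[OF assms(1,4)] cl subset_refl in_carried_supp[OF assms(1,4)]])
qed

text \<open>
  The image of the element is the image of an element carried by the part of the support that is
  mapped into the new support; by injectivity this is the element itself.
\<close>

lemma supp_mor_inj:
  assumes XY: "compactum X" "compactum Y" "continuous_map X Y f" and inj: "inj_on f (topspace X)"
    and a: "a \<in> topspace (obj G X)"
  shows "supp Y (mor G X Y f a) = f ` supp X a"
proof
  show "supp Y (mor G X Y f a) \<subseteq> f ` supp X a"
    by (rule supp_mor_subset[OF XY a])
  define R where "R = {x \<in> supp X a. f x \<in> supp Y (mor G X Y f a)}"
  have fa: "mor G X Y f a \<in> topspace (obj G Y)"
    by (rule mor_in[OF XY a])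
  have R: "closedin X R"
    unfolding R_def using finite_supp[OF XY(1) a] supp_subset[OF XY(1) a] XY(1)
    by (intro closedin_finite) auto
  have "supp Y (mor G X Y f a) \<subseteq> f ` R"
    using supp_mor_subset[OF XY a] unfolding R_def by auto
  then have "mor G X Y f a \<in> mor G X Y f ` carried G X R"
    by (intro lift_carried[OF XY R closedin_supp[OF XY(2) fa]] in_carried_supp XY fa)
  then obtain b where b: "b \<in> carried G X R" "mor G X Y f a = mor G X Y f b"
    by blast
  have "b \<in> topspace (obj G X)"
    using b(1) carried_subset[OF XY(1) R] by blast
  then have "a = b"
    by (intro mor_inj[OF XY inj a _ b(2)])
  then have "supp X a \<subseteq> R"
    using supp_least[OF R] b(1) by simp
  then show "f ` supp X a \<subseteq> supp Y (mor G X Y f a)"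
    unfolding R_def by blast
qed

end

section \<open>Limits of inverse spectra\<close>

lemma inverse_spectrumD:
  assumes "inverse_spectrum I le X p"
  shows "I \<noteq> {}" "\<And>i. i \<in> I \<Longrightarrow> le i i"
    "\<And>i j k. i \<in> I \<Longrightarrow> j \<in> I \<Longrightarrow> k \<in> I \<Longrightarrow> le i j \<Longrightarrow> le j k \<Longrightarrow> le i k"
    "\<And>i j. i \<in> I \<Longrightarrow> j \<in> I \<Longrightarrow> \<exists>k\<in>I. le i k \<and> le j k"
    "\<And>i. i \<in> I \<Longrightarrow> compactum (X i)"
    "\<And>i j. i \<in> I \<Longrightarrow> j \<in> I \<Longrightarrow> le i j \<Longrightarrow> continuous_map (X j) (X i) (p i j)"
    "\<And>i x. i \<in> I \<Longrightarrow> x \<in> topspace (X i) \<Longrightarrow> p i i x = x"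
    "\<And>i j k x. i \<in> I \<Longrightarrow> j \<in> I \<Longrightarrow> k \<in> I \<Longrightarrow> le i j \<Longrightarrow> le j k \<Longrightarrow> x \<in> topspace (X k)
      \<Longrightarrow> p i j (p j k x) = p i k x"
proof -
  note a = assms[unfolded inverse_spectrum_def]
  show "I \<noteq> {}"
    by (rule a[THEN conjunct1])
  show "le i i" if "i \<in> I" for i
    by (rule a[THEN conjunct2, THEN conjunct1, rule_format, OF that])
  show "le i k" if "i \<in> I" "j \<in> I" "k \<in> I" "le i j" "le j k" for i j k
    by (rule a[THEN conjunct2, THEN conjunct2, THEN conjunct1, rule_format, OF that(1,2,3) conjI[OF that(4,5)]])
  show "\<exists>k\<in>I. le i k \<and> le j k" if "i \<in> I" "j \<in> I" for i j
    by (rule a[THEN conjunct2, THEN conjunct2, THEN conjunct2, THEN conjunct1, rule_format, OF that])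
  show "compactum (X i)" if "i \<in> I" for i
    by (rule a[THEN conjunct2, THEN conjunct2, THEN conjunct2, THEN conjunct2, THEN conjunct1, rule_format, OF that])
  show "continuous_map (X j) (X i) (p i j)" if "i \<in> I" "j \<in> I" "le i j" for i j
    by (rule a[THEN conjunct2, THEN conjunct2, THEN conjunct2, THEN conjunct2, THEN conjunct2, THEN conjunct1, rule_format, OF that])
  show "p i i x = x" if "i \<in> I" "x \<in> topspace (X i)" for i x
    by (rule a[THEN conjunct2, THEN conjunct2, THEN conjunct2, THEN conjunct2, THEN conjunct2, THEN conjunct2, THEN conjunct1, rule_format, OF that])
  show "p i j (p j k x) = p i k x"
    if "i \<in> I" "j \<in> I" "k \<in> I" "le i j" "le j k" "x \<in> topspace (X k)" for i j k x
    by (rule a[THEN conjunct2, THEN conjunct2, THEN conjunct2, THEN conjunct2, THEN conjunct2, THEN conjunct2, THEN conjunct2, rule_format, OF that(1,2,3) conjI[OF that(4,5)] that(6)])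
qed

lemma threadsD:
  assumes "t \<in> threads I le X p"
  shows "t \<in> (\<Pi>\<^sub>E i\<in>I. topspace (X i))" "\<And>i. i \<in> I \<Longrightarrow> t i \<in> topspace (X i)"
    "\<And>i j. i \<in> I \<Longrightarrow> j \<in> I \<Longrightarrow> le i j \<Longrightarrow> p i j (t j) = t i"
proof -
  have t: "t \<in> (\<Pi>\<^sub>E i\<in>I. topspace (X i))" and r: "\<forall>i\<in>I. \<forall>j\<in>I. le i j \<longrightarrow> p i j (t j) = t i"
    using assms unfolding threads_def by blast+
  show "t \<in> (\<Pi>\<^sub>E i\<in>I. topspace (X i))"
    by (rule t)
  show "t i \<in> topspace (X i)" if "i \<in> I" for i
    by (rule PiE_mem[OF t that])
  show "p i j (t j) = t i" if "i \<in> I" "j \<in> I" "le i j" for i j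
    by (rule r[rule_format, OF that])
qed

lemma topspace_limit: "topspace (subtopology (product_topology X I) (threads I le X p)) = threads I le X p"
  unfolding threads_def by auto

lemma spectrum_upper_bound:
  assumes "inverse_spectrum I le X p" "finite K" "K \<subseteq> I"
  shows "\<exists>l\<in>I. \<forall>k\<in>K. le k l"
  using assms(2,3)
proof (induction K rule: finite_induct)
  case empty
  then show ?case
    using inverse_spectrumD(1)[OF assms(1)] by blast
next
  case (insert j K)
  then obtain l where l: "l \<in> I" "\<forall>k\<in>K. le k l"
    by blast
  obtain m where m: "m \<in> I" "le j m" "le l m"
    using inverse_spectrumD(4)[OF assms(1), of j l] insert.prems l(1) by blast
  have "le k m" if "k \<in> K" for k
    using inverse_spectrumD(3)[OF assms(1), of k l m] that l m insert.prems by blast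
  with m show ?case
    by blast
qed

lemma
  assumes lim: "spectrum_limit I le X p L \<pi>"
  shows limit_continuous: "\<And>i. i \<in> I \<Longrightarrow> continuous_map L (X i) (\<pi> i)"
    and limit_thread: "\<And>x. x \<in> topspace L \<Longrightarrow> (\<lambda>i\<in>I. \<pi> i x) \<in> threads I le X p"
    and limit_surj: "\<And>t. t \<in> threads I le X p \<Longrightarrow> \<exists>x\<in>topspace L. \<forall>i\<in>I. \<pi> i x = t i"
    and limit_inj: "\<And>x y. x \<in> topspace L \<Longrightarrow> y \<in> topspace L \<Longrightarrow> (\<And>i. i \<in> I \<Longrightarrow> \<pi> i x = \<pi> i y) \<Longrightarrow> x = y"
proof -
  let ?h = "\<lambda>x. \<lambda>i\<in>I. \<pi> i x"
  have h: "homeomorphic_map L (subtopology (product_topology X I) (threads I le X p)) ?h"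
    using lim unfolding spectrum_limit_def .
  have "continuous_map L (product_topology X I) ?h"
    using homeomorphic_imp_continuous_map[OF h] by (simp add: continuous_map_in_subtopology)
  then show "continuous_map L (X i) (\<pi> i)" if "i \<in> I" for i
    using that unfolding continuous_map_componentwise by simp
  have im: "?h ` topspace L = threads I le X p"
    using homeomorphic_imp_surjective_map[OF h] unfolding topspace_limit .
  then show "?h x \<in> threads I le X p" if "x \<in> topspace L" for x
    using that by blast
  show "\<exists>x\<in>topspace L. \<forall>i\<in>I. \<pi> i x = t i" if t: "t \<in> threads I le X p" for t
  proof -
    obtain x where "x \<in> topspace L" "t = ?h x"
      using im t by blast
    then show ?thesis
      by (intro bexI[of _ x]) simp_all
  qed
  show "x = y" if "x \<in> topspace L" "y \<in> topspace L" "\<And>i. i \<in> I \<Longrightarrow> \<pi> i x = \<pi> i y" for x y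
    using homeomorphic_imp_injective_map[OF h]
    by (rule inj_onD[OF _ _ that(1,2)]) (use that(3) in \<open>simp add: restrict_def fun_eq_iff\<close>)
qed

lemma limit_compatible:
  assumes "spectrum_limit I le X p L \<pi>" "i \<in> I" "j \<in> I" "le i j" "x \<in> topspace L"
  shows "p i j (\<pi> j x) = \<pi> i x"
  using threadsD(3)[OF limit_thread[OF assms(1,5)] assms(2-4)] assms(2,3) by simp

text \<open>
  A point in the images of all later spaces extends to a thread. The families of coordinates that
  are compatible below \<open>j\<close> and take the value \<open>x\<close> at \<open>i\<close> form a closed set, non-empty because \<open>x\<close>
  comes from the \<open>j\<close>-th space, and these sets shrink as \<open>j\<close> grows.
\<close>

lemma limit_projection:
  assumes spec: "inverse_spectrum I le X p" and lim: "spectrum_limit I le X p L \<pi>" and i: "i \<in> I"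
    and x: "\<And>j. j \<in> I \<Longrightarrow> le i j \<Longrightarrow> x \<in> p i j ` topspace (X j)"
  shows "x \<in> \<pi> i ` topspace L"
proof -
  note S = inverse_spectrumD[OF spec]
  have pin: "p k j y \<in> topspace (X k)" if "k \<in> I" "j \<in> I" "le k j" "y \<in> topspace (X j)" for k j y
    using S(6)[OF that(1-3)] that(4) by (auto simp: continuous_map_def)
  let ?P = "product_topology X I"
  have cP: "compact_space ?P" and hP: "Hausdorff_space ?P"
    using S(5) by (auto simp: compact_space_product_topology Hausdorff_space_product_topology compactum_def)
  have ne: "topspace (X k) \<noteq> {}" if k: "k \<in> I" for k
  proof -
    obtain m where "m \<in> I" "le i m" "le k m"
      using S(4)[OF i k] by blast
    then show ?thesis
      using x[of m] pin[of k m] k by blast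
  qed
  define J where "J = {j \<in> I. le i j}"
  define E where "E k j = {t \<in> topspace ?P. p k j (t j) = t k}" for k j
  define C where "C j = {t \<in> topspace ?P. t i = x} \<inter> (\<Inter>k\<in>{k \<in> I. le k j}. E k j)" for j
  have proj: "continuous_map ?P (X k) (\<lambda>t. t k)" if "k \<in> I" for k
    using that by (rule continuous_map_product_projection)
  have cl: "closedin ?P (C j)" if j: "j \<in> J" for j
  proof -
    have jI: "j \<in> I"
      using j by (simp add: J_def)
    have "x \<in> topspace (X i)"
      using x[OF i S(2)[OF i]] pin[OF i i S(2)[OF i]] by blast
    then have "closedin ?P {t \<in> topspace ?P. t i = x}"
      using S(5)[OF i] i by (intro closedin_continuous_maps_eq[OF _ proj]) (simp_all add: compactum_def)
    moreover have "closedin ?P (E k j)" if "k \<in> I" "le k j" for k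
      unfolding E_def using S(5)[OF that(1)] proj[OF that(1)]
        continuous_map_compose[OF proj[OF jI] S(6)[OF that(1) jI that(2)]]
      by (intro closedin_continuous_maps_eq[of "X k"]) (simp_all add: compactum_def o_def)
    moreover have "{k \<in> I. le k j} \<noteq> {}"
      using jI S(2) by blast
    ultimately show ?thesis
      unfolding C_def by (intro closedin_Int closedin_Inter) auto
  qed
  have nonempty: "C j \<noteq> {}" if j: "j \<in> J" for j
  proof -
    have jI: "j \<in> I" and ij: "le i j"
      using j by (simp_all add: J_def)
    obtain y where y: "y \<in> topspace (X j)" "x = p i j y"
      using x[OF jI ij] by blast
    \<comment> \<open>Coordinates not below \<open>j\<close> are unconstrained in \<open>C j\<close>.\<close>
    define t where "t = (\<lambda>k\<in>I. if le k j then p k j y else SOME z. z \<in> topspace (X k))"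
    have "t k \<in> topspace (X k)" if "k \<in> I" for k
      using that pin[OF that jI _ y(1)] some_in_eq[of "topspace (X k)"] ne[OF that] by (simp add: t_def)
    then have "t \<in> topspace ?P"
      by (simp add: PiE_iff t_def)
    moreover have "t j = y"
      using jI S(2)[OF jI] S(7)[OF jI y(1)] by (simp add: t_def)
    moreover have "t k = p k j y" if "k \<in> I" "le k j" for k
      using that by (simp add: t_def)
    ultimately have "t \<in> C j"
      using i ij y(2) by (simp add: C_def E_def)
    then show ?thesis
      by blast
  qed
  have mono: "C l \<subseteq> C j" if j: "j \<in> J" "l \<in> I" "le j l" for j l
  proof
    fix t assume t: "t \<in> C l"
    then have tP: "t \<in> topspace ?P" and "t i = x" and tl: "\<And>k. k \<in> I \<Longrightarrow> le k l \<Longrightarrow> p k l (t l) = t k"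
      by (simp_all add: C_def E_def)
    have jI: "j \<in> I"
      using j(1) by (simp add: J_def)
    have tlX: "t l \<in> topspace (X l)"
      using tP j(2) by (simp add: PiE_iff)
    have "p k j (t j) = t k" if k: "k \<in> I" "le k j" for k
      using tl[OF jI j(3)] tl[OF k(1) S(3)[OF k(1) jI j(2) k(2) j(3)]]
        S(8)[OF k(1) jI j(2) k(2) j(3) tlX] by simp
    then show "t \<in> C j"
      using tP \<open>t i = x\<close> by (simp add: C_def E_def)
  qed
  have "\<exists>t\<in>topspace ?P. \<forall>j\<in>J. t \<in> C j"
  proof (rule compact_directed_Inter_nonempty[OF cP])
    show "J \<noteq> {}"
      using i S(2) by (auto simp: J_def)
    fix j k assume jk: "j \<in> J" "k \<in> J"
    then obtain l where l: "l \<in> I" "le j l" "le k l"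
      using S(4) by (auto simp: J_def)
    then have "l \<in> J"
      using S(3)[OF i _ l(1), of j] jk(1) by (simp add: J_def)
    then show "\<exists>l\<in>J. C l \<subseteq> C j \<inter> C k"
      using mono[OF jk(1) l(1,2)] mono[OF jk(2) l(1,3)] by blast
  qed (fact cl nonempty)+
  then obtain t where t: "t \<in> topspace ?P" "\<forall>j\<in>J. t \<in> C j"
    by blast
  have tj: "p k j (t j) = t k" if "j \<in> J" "k \<in> I" "le k j" for j k
    using t(2) that by (simp add: C_def E_def)
  have "p a b (t b) = t a" if ab: "a \<in> I" "b \<in> I" "le a b" for a b
  proof -
    obtain j where j: "j \<in> I" "le b j" "le i j"
      using S(4)[OF ab(2) i] by blast
    then have jJ: "j \<in> J"
      by (simp add: J_def)
    have "t j \<in> topspace (X j)"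
      using t(1) j(1) by (simp add: PiE_iff)
    from S(8)[OF ab(1,2) j(1) ab(3) j(2) this] show ?thesis
      using tj[OF jJ ab(2) j(2)] tj[OF jJ ab(1) S(3)[OF ab(1,2) j(1) ab(3) j(2)]] by simp
  qed
  then have "t \<in> threads I le X p"
    using t(1) unfolding threads_def by simp
  then obtain z where "z \<in> topspace L" "\<pi> i z = t i"
    using limit_surj[OF lim] i by blast
  moreover have "t i = x"
    using t(2) i S(2)[OF i] by (simp add: J_def C_def)
  ultimately show ?thesis
    by (intro image_eqI[of _ _ z]) simp_all
qed

text \<open>
  Each pair of distinct points is separated by some projection, hence by all later ones.
\<close>

lemma projection_inj_on_finite:
  assumes spec: "inverse_spectrum I le X p" and lim: "spectrum_limit I le X p L \<pi>"
    and K: "finite K" "K \<subseteq> topspace L"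
  shows "\<exists>i\<in>I. inj_on (\<pi> i) K"
proof -
  define D where "D = {xy \<in> K \<times> K. fst xy \<noteq> snd xy}"
  have "\<forall>xy\<in>D. \<exists>i. i \<in> I \<and> \<pi> i (fst xy) \<noteq> \<pi> i (snd xy)"
  proof
    fix xy assume xy: "xy \<in> D"
    then have "fst xy \<in> topspace L" "snd xy \<in> topspace L" "fst xy \<noteq> snd xy"
      using K(2) unfolding D_def by auto
    then show "\<exists>i. i \<in> I \<and> \<pi> i (fst xy) \<noteq> \<pi> i (snd xy)"
      using limit_inj[OF lim, of "fst xy" "snd xy"] by blast
  qed
  from bchoice[OF this] obtain \<iota> where \<iota>: "\<forall>xy\<in>D. \<iota> xy \<in> I \<and> \<pi> (\<iota> xy) (fst xy) \<noteq> \<pi> (\<iota> xy) (snd xy)"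
    by (rule exE)
  have "finite D"
    using K(1) by (simp add: D_def)
  then obtain l where l: "l \<in> I" "\<forall>k\<in>\<iota> ` D. le k l"
    using spectrum_upper_bound[OF spec, of "\<iota> ` D"] \<iota> by blast
  have "inj_on (\<pi> l) K"
  proof (rule inj_onI, rule ccontr)
    fix x y assume xy: "x \<in> K" "y \<in> K" "\<pi> l x = \<pi> l y" "x \<noteq> y"
    let ?k = "\<iota> (x, y)"
    have D: "(x, y) \<in> D"
      using xy by (simp add: D_def)
    then have k: "?k \<in> I" "le ?k l" "\<pi> ?k x \<noteq> \<pi> ?k y"
      using \<iota> l(2) by auto
    show False
      using limit_compatible[OF lim k(1) l(1) k(2), of x] limit_compatible[OF lim k(1) l(1) k(2), of y]
        xy K(2) k(3) by (simp add: subsetD)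
  qed
  with l(1) show ?thesis
    by blast
qed

context maximal_functor
begin

text \<open>
  Supports reduce injectivity to finite sets. Surjectivity follows by compactness from the fact that
  each coordinate of a thread has its support in the projection of the limit.
\<close>

lemma is_continuous: "continuous_functor TYPE('i) G"
  unfolding continuous_functor_def
proof (intro allI impI, elim conjE)
  fix I :: "'i set" and le and X :: "'i \<Rightarrow> 'a topology" and p L \<pi>
  assume spec: "inverse_spectrum I le X p" and L: "compactum L" and lim: "spectrum_limit I le X p L \<pi>"
  note S = inverse_spectrumD[OF spec]
  let ?GX = "\<lambda>i. obj G (X i)" and ?Gp = "\<lambda>i j. mor G (X j) (X i) (p i j)"
  let ?G\<pi> = "\<lambda>i. mor G L (X i) (\<pi> i)"
  let ?T = "threads I le ?GX ?Gp" and ?h = "\<lambda>a. \<lambda>i\<in>I. ?G\<pi> i a"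
  have c\<pi>: "continuous_map L (X i) (\<pi> i)" if "i \<in> I" for i
    using limit_continuous[OF lim that] .
  have G\<pi>: "?G\<pi> i a \<in> topspace (?GX i)" if "i \<in> I" "a \<in> topspace (obj G L)" for i a
    using mor_in[OF L S(5) c\<pi>] that by blast
  have comp: "?Gp i j (?G\<pi> j a) = ?G\<pi> i a" if "i \<in> I" "j \<in> I" "le i j" "a \<in> topspace (obj G L)" for i j a
    using that by (intro mor_comp L S(5,6) c\<pi> limit_compatible[OF lim])
  have thread: "?h a \<in> ?T" if "a \<in> topspace (obj G L)" for a
    unfolding threads_def using that G\<pi> comp by simp
  have inj: "inj_on ?h (topspace (obj G L))"
  proof (rule inj_onI)
    fix a b assume a: "a \<in> topspace (obj G L)" and b: "b \<in> topspace (obj G L)" and eq: "?h a = ?h b"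
    define K where "K = supp L a \<union> supp L b"
    have K: "finite K" "K \<subseteq> topspace L"
      unfolding K_def using finite_supp[OF L] supp_subset[OF L] a b by simp_all
    have clK: "closedin L K"
      by (rule closedin_finite[OF L K])
    obtain i where i: "i \<in> I" "inj_on (\<pi> i) K"
      using projection_inj_on_finite[OF spec lim K] by blast
    let ?K = "subtopology L K"
    have cK: "compactum ?K" and KL: "continuous_map ?K L id" and KX: "continuous_map ?K (X i) (\<pi> i)"
      using compactum_closed_subspace[OF L clK] c\<pi>[OF i(1)]
      by (simp_all add: continuous_map_from_subtopology)
    have "a \<in> carried G L K" "b \<in> carried G L K"
      using in_carried_iff[OF L clK] a b by (simp_all add: K_def)
    then obtain a' b' where a': "a' \<in> topspace (obj G ?K)" "a = mor G ?K L id a'"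
        and b': "b' \<in> topspace (obj G ?K)" "b = mor G ?K L id b'"
      unfolding carried_def by blast
    have "mor G ?K (X i) (\<pi> i) c = ?G\<pi> i (mor G ?K L id c)" if "c \<in> topspace (obj G ?K)" for c
      by (rule mor_comp[OF cK L S(5)[OF i(1)] KL c\<pi>[OF i(1)] that, symmetric]) simp
    moreover have "?G\<pi> i a = ?G\<pi> i b"
      using fun_cong[OF eq, of i] i(1) by simp
    ultimately have "mor G ?K (X i) (\<pi> i) a' = mor G ?K (X i) (\<pi> i) b'"
      using a' b' by simp
    moreover have "inj_on (\<pi> i) (topspace ?K)"
      using i(2) by (rule inj_on_subset) simp
    ultimately have "a' = b'"
      by (intro mor_inj[OF cK S(5)[OF i(1)] KX _ a'(1) b'(1)])
    then show "a = b"
      using a'(2) b'(2) by simp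
  qed
  have surj: "\<exists>a\<in>topspace (obj G L). ?h a = t" if t: "t \<in> ?T" for t
  proof -
    define C where "C i = {b \<in> topspace (obj G L). ?G\<pi> i b = t i}" for i
    have tX: "t i \<in> topspace (?GX i)" if "i \<in> I" for i
      using threadsD(2)[OF t that] .
    have "\<exists>b\<in>topspace (obj G L). \<forall>i\<in>I. b \<in> C i"
    proof (rule compact_directed_Inter_nonempty)
      show "compact_space (obj G L)"
        using obj_compactum[OF L] by (simp add: compactum_def)
      show "I \<noteq> {}"
        by (rule S(1))
      fix i assume i: "i \<in> I"
      have "Hausdorff_space (?GX i)"
        using obj_compactum[OF S(5)[OF i]] by (simp add: compactum_def)
      then show "closedin (obj G L) (C i)"
        unfolding C_def using mor_continuous[OF L S(5)[OF i] c\<pi>[OF i]] tX[OF i]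
        by (intro closedin_continuous_maps_eq[of "?GX i"]) simp_all
      have "supp (X i) (t i) \<subseteq> p i j ` topspace (X j)" if j: "j \<in> I" "le i j" for j
      proof (rule supp_least)
        show cl: "closedin (X i) (p i j ` topspace (X j))"
          by (rule closedin_continuous_image[OF S(5)[OF j(1)] S(5)[OF i] S(6)[OF i j] closedin_topspace])
        have "?Gp i j (t j) \<in> carried G (X i) (p i j ` topspace (X j))"
          by (rule mor_in_carried[OF S(5)[OF j(1)] S(5)[OF i] cl S(6)[OF i j] subset_refl tX[OF j(1)]])
        then show "t i \<in> carried G (X i) (p i j ` topspace (X j))"
          using threadsD(3)[OF t i j] by simp
      qed
      then have sub: "supp (X i) (t i) \<subseteq> \<pi> i ` topspace L"
        by (intro subsetI limit_projection[OF spec lim i]) (rule subsetD)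
      have "t i \<in> ?G\<pi> i ` carried G L (topspace L)"
        by (rule lift_carried[OF L S(5)[OF i] c\<pi>[OF i] closedin_topspace
              closedin_supp[OF S(5)[OF i] tX[OF i]] sub in_carried_supp[OF S(5)[OF i] tX[OF i]]])
      then show "C i \<noteq> {}"
        unfolding carried_topspace[OF L] C_def by auto
    next
      fix i j assume ij: "i \<in> I" "j \<in> I"
      obtain l where l: "l \<in> I" "le i l" "le j l"
        using S(4)[OF ij] by blast
      have "C l \<subseteq> C k" if k: "k \<in> I" "le k l" for k
      proof
        fix a assume "a \<in> C l"
        then have a: "a \<in> topspace (obj G L)" "?G\<pi> l a = t l"
          by (simp_all add: C_def)
        have "?G\<pi> k a = t k"
          using comp[OF k(1) l(1) k(2) a(1)] threadsD(3)[OF t k(1) l(1) k(2)] unfolding a(2) by simp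
        with a(1) show "a \<in> C k"
          by (simp add: C_def)
      qed
      from Int_greatest[OF this[OF ij(1) l(2)] this[OF ij(2) l(3)]]
      show "\<exists>l\<in>I. C l \<subseteq> C i \<inter> C j"
        using l(1) by (rule bexI)
    qed
    then obtain b where b: "b \<in> topspace (obj G L)" and bC: "\<forall>i\<in>I. b \<in> C i"
      by (rule bexE)
    have bt: "?G\<pi> i b = t i" if "i \<in> I" for i
      using bspec[OF bC that] by (simp add: C_def)
    have "?h b = t"
    proof
      fix i show "?h b i = t i"
        using bt[of i] PiE_arb[OF threadsD(1)[OF t], of i] by (cases "i \<in> I") simp_all
    qed
    with b show ?thesis
      by (intro bexI[of _ b])
  qed
  show "spectrum_limit I le ?GX ?Gp (obj G L) ?G\<pi>"
    unfolding spectrum_limit_def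
  proof (rule continuous_imp_homeomorphic_map)
    show "continuous_map (obj G L) (subtopology (product_topology ?GX I) ?T) ?h"
      unfolding continuous_map_in_subtopology
    proof
      have "continuous_map (obj G L) (?GX i) (\<lambda>a. ?h a i)" if "i \<in> I" for i
        using mor_continuous[OF L S(5)[OF that] c\<pi>[OF that]] that by simp
      moreover have "?h a \<in> extensional I" for a
        by (rule restrict_extensional)
      ultimately show "continuous_map (obj G L) (product_topology ?GX I) ?h"
        unfolding continuous_map_componentwise by blast
      show "?h \<in> topspace (obj G L) \<rightarrow> ?T"
        by (intro funcsetI thread)
    qed
    show "compact_space (obj G L)"
      using obj_compactum[OF L] by (simp add: compactum_def)
    show "Hausdorff_space (subtopology (product_topology ?GX I) ?T)"
      using obj_compactum[OF S(5)]
      by (intro Hausdorff_space_subtopology) (simp add: Hausdorff_space_product_topology compactum_def)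
    show "?h ` topspace (obj G L) = topspace (subtopology (product_topology ?GX I) ?T)"
      unfolding topspace_limit
    proof (intro equalityI subsetI)
      fix t assume "t \<in> ?T"
      from surj[OF this] show "t \<in> ?h ` topspace (obj G L)"
        by (auto intro: image_eqI)
    next
      fix t assume "t \<in> ?h ` topspace (obj G L)"
      then show "t \<in> ?T"
        using thread by (elim imageE) simp
    qed
    show "inj_on ?h (topspace (obj G L))"
      by (rule inj)
  qed
qed

end

section \<open>Joint continuity in the map and the element\<close>

context maximal_functor
begin

text \<open>
  Let \<open>S\<close> be the range of \<open>f\<close>, a finite set. Some closed neighbourhood \<open>V0\<close> of \<open>S\<close> is a disjoint union
  of neighbourhoods of the points of \<open>S\<close>, so it has a retraction \<open>r\<close> onto \<open>S\<close>, and \<open>r \<circ> g = f\<close> for all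
  \<open>g\<close> close to \<open>f\<close>. A limit of elements \<open>G g c'\<close>, where \<open>g\<close> tends to \<open>f\<close> and \<open>c'\<close> to \<open>c\<close>, is carried by
  all neighbourhoods of \<open>S\<close>, hence by \<open>S\<close>, and thus fixed by \<open>r\<close>; but \<open>r\<close> sends it to \<open>G f c\<close>. So
  \<open>G f c\<close> is the only limit point, and compactness gives the claim.
\<close>

lemma joint_continuity:
  assumes A: "finite A" and X: "compactum X" and f: "f ` A \<subseteq> topspace X"
    and c: "c \<in> topspace (obj G (discrete_topology A))"
    and N: "openin (obj G X) N" "mor G (discrete_topology A) X f c \<in> N"
  shows "\<exists>U W. (\<forall>x\<in>A. openin X (U x) \<and> f x \<in> U x) \<and> openin (obj G (discrete_topology A)) W \<and> c \<in> W \<and>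
    (\<forall>g. (\<forall>x\<in>A. g x \<in> U x) \<longrightarrow> (\<forall>c'\<in>W. mor G (discrete_topology A) X g c' \<in> N))"
proof -
  define S where "S = f ` A"
  have S: "finite S" "S \<subseteq> topspace X"
    using A f by (simp_all add: S_def)
  let ?A = "discrete_topology A" and ?D = "discrete_topology S"
  have cA: "compactum ?A" and cD: "compactum ?D"
    using A S by (simp_all add: compactum_finite_discrete)
  have GX: "compactum (obj G X)" and GD: "compactum (obj G ?D)"
    using X cD by (simp_all add: obj_compactum)
  obtain V where V: "\<And>s. s \<in> S \<Longrightarrow> openin X (V s)" "\<And>s. s \<in> S \<Longrightarrow> s \<in> V s"
      "\<And>s t. s \<in> S \<Longrightarrow> t \<in> S \<Longrightarrow> s \<noteq> t \<Longrightarrow> V s \<inter> V t = {}"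
    using X finite_disjoint_open_neighbourhoods[OF _ S] unfolding compactum_def by metis
  have "openin X (\<Union>(V ` S))"
    using V(1) by (intro openin_Union) auto
  moreover have "S \<subseteq> \<Union>(V ` S)"
    using V(2) by blast
  ultimately obtain P0 where P0: "openin X P0" "S \<subseteq> P0" "X closure_of P0 \<subseteq> \<Union>(V ` S)"
    using compactum_shrink[OF X closedin_finite[OF X S]] by metis
  define V0 where "V0 = X closure_of P0"
  have V0: "closedin X V0" "P0 \<subseteq> V0" "V0 \<subseteq> topspace X"
    using P0(1) by (simp_all add: V0_def closure_of_subset openin_subset closure_of_subset_topspace)
  have SV0: "S \<subseteq> V0"
    using P0(2) V0(2) by (rule subset_trans)
  let ?Z = "subtopology X V0"
  have tZ: "topspace ?Z = V0"
    using V0(3) by auto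
  have cZ: "compactum ?Z"
    by (rule compactum_closed_subspace[OF X V0(1)])
  have GZ: "compactum (obj G ?Z)"
    by (rule obj_compactum[OF cZ])
  define r where "r x = (SOME s. s \<in> S \<and> x \<in> V s)" for x
  have r: "r x = s" if "s \<in> S" "x \<in> V s" for s x
    unfolding r_def
  proof (rule some_equality)
    show "t = s" if "t \<in> S \<and> x \<in> V t" for t
      using V(3)[of t s] that \<open>s \<in> S\<close> \<open>x \<in> V s\<close> by blast
  qed (use that in simp)
  have rS: "r x \<in> S" "x \<in> V (r x)" if x: "x \<in> V0" for x
  proof -
    obtain s where s: "s \<in> S" "x \<in> V s"
      using P0(3) x unfolding V0_def by blast
    show "r x \<in> S" "x \<in> V (r x)"
      using s r[OF s] by simp_all
  qed
  have rD: "continuous_map ?Z ?D r"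
    unfolding continuous_map_def
  proof (intro conjI allI impI)
    show "r \<in> topspace ?Z \<rightarrow> topspace ?D"
      using rS(1) tZ by simp
    fix T assume "openin ?D T"
    then have T: "T \<subseteq> S"
      by simp
    have "{x \<in> topspace ?Z. r x \<in> T} = \<Union>(V ` T) \<inter> V0"
    proof (intro equalityI subsetI)
      fix x assume "x \<in> {x \<in> topspace ?Z. r x \<in> T}"
      then show "x \<in> \<Union>(V ` T) \<inter> V0"
        using rS(2) tZ by blast
    next
      fix x assume "x \<in> \<Union>(V ` T) \<inter> V0"
      then obtain s where "s \<in> T" "x \<in> V s" "x \<in> V0"
        by blast
      then show "x \<in> {x \<in> topspace ?Z. r x \<in> T}"
        using r[of s x] T tZ by auto
    qed
    moreover have "openin X (\<Union>(V ` T))"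
      using V(1) T by (intro openin_Union) auto
    ultimately show "openin ?Z {x \<in> topspace ?Z. r x \<in> T}"
      unfolding openin_subtopology by blast
  qed
  have DZ: "continuous_map ?D ?Z id" and AD: "continuous_map ?A ?D f" and DX: "continuous_map ?D X id"
    and ZX: "continuous_map ?Z X id"
    unfolding continuous_map_discrete_domain using SV0 tZ S(2)
    by (simp_all add: S_def continuous_map_from_subtopology)
  define d where "d = mor G ?A ?D f c"
  have d: "d \<in> topspace (obj G ?D)"
    unfolding d_def by (rule mor_in[OF cA cD AD c])
  \<comment> \<open>Elements over \<open>V0\<close> that are close to \<open>G f c\<close> up to neighbourhoods \<open>P\<close> of \<open>S\<close> and \<open>Q\<close> of \<open>d\<close>, but whose
    image is not in \<open>N\<close>.\<close>
  define J where "J = {PQ. openin X (fst PQ) \<and> S \<subseteq> fst PQ \<and> openin (obj G ?D) (snd PQ) \<and> d \<in> snd PQ}"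
  define C where "C PQ = {b \<in> topspace (obj G ?Z). mor G ?Z X id b \<in> topspace (obj G X) - N} \<inter>
      carried G ?Z (V0 \<inter> X closure_of fst PQ) \<inter>
      {b \<in> topspace (obj G ?Z). mor G ?Z ?D r b \<in> obj G ?D closure_of snd PQ}" for PQ
  have clZ: "closedin ?Z (V0 \<inter> X closure_of P)" for P
    by (intro closedin_subtopology_Int_closed closedin_closure_of)
  have "\<exists>PQ\<in>J. C PQ = {}"
  proof (rule ccontr)
    assume "\<not> (\<exists>PQ\<in>J. C PQ = {})"
    then have ne: "C PQ \<noteq> {}" if "PQ \<in> J" for PQ
      using that by blast
    have "\<exists>b\<in>topspace (obj G ?Z). \<forall>PQ\<in>J. b \<in> C PQ"
    proof (rule compact_directed_Inter_nonempty)
      show "compact_space (obj G ?Z)"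
        using GZ by (simp add: compactum_def)
      have "(topspace X, topspace (obj G ?D)) \<in> J"
        using S(2) d by (simp add: J_def)
      then show "J \<noteq> {}"
        by blast
      show "closedin (obj G ?Z) (C PQ)" for PQ
        unfolding C_def
        by (intro closedin_Int closedin_continuous_map_preimage[OF mor_continuous[OF cZ X ZX]]
            closedin_continuous_map_preimage[OF mor_continuous[OF cZ cD rD]]
            closedin_carried[OF cZ clZ] closedin_diff closedin_topspace N(1) closedin_closure_of)
      show "C PQ \<noteq> {}" if "PQ \<in> J" for PQ
        by (rule ne[OF that])
      fix j k assume jk: "j \<in> J" "k \<in> J"
      define l where "l = (fst j \<inter> fst k, snd j \<inter> snd k)"
      have "l \<in> J"
        using jk by (simp add: J_def l_def openin_Int)
      have "C l \<subseteq> C m" if "fst l \<subseteq> fst m" "snd l \<subseteq> snd m" for m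
      proof -
        have "V0 \<inter> X closure_of fst l \<subseteq> V0 \<inter> X closure_of fst m"
          using closure_of_mono[OF that(1)] by (rule Int_mono[OF subset_refl])
        then show ?thesis
          unfolding C_def using carried_mono[OF cZ clZ clZ, of "fst l" "fst m"]
            closure_of_mono[OF that(2), of "obj G ?D"] by blast
      qed
      from this[of j] this[of k] have "C l \<subseteq> C j \<inter> C k"
        by (simp add: l_def)
      with \<open>l \<in> J\<close> show "\<exists>l\<in>J. C l \<subseteq> C j \<inter> C k"
        by (intro bexI)
    qed
    then obtain b where b: "b \<in> topspace (obj G ?Z)" and bC: "\<forall>PQ\<in>J. b \<in> C PQ"
      by (rule bexE)
    have bC': "mor G ?Z X id b \<notin> N" "supp ?Z b \<subseteq> X closure_of P" "mor G ?Z ?D r b \<in> obj G ?D closure_of Q"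
      if "openin X P" "S \<subseteq> P" "openin (obj G ?D) Q" "d \<in> Q" for P Q
    proof -
      have "(P, Q) \<in> J"
        using that by (simp add: J_def)
      from bspec[OF bC this] show "mor G ?Z X id b \<notin> N" "supp ?Z b \<subseteq> X closure_of P"
          "mor G ?Z ?D r b \<in> obj G ?D closure_of Q"
        using supp_least[OF clZ, of b P] by (simp_all add: C_def)
    qed
    have "supp ?Z b \<subseteq> S"
    proof (rule subsetI, rule ccontr)
      fix z assume z: "z \<in> supp ?Z b" "z \<notin> S"
      have zX: "z \<in> topspace X"
        using supp_subset[OF cZ b] z(1) tZ V0(3) by blast
      have "S \<subseteq> topspace X - {z}"
        using S(2) z(2) by blast
      then obtain P where "openin X P" "S \<subseteq> P" "X closure_of P \<subseteq> topspace X - {z}"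
        by (rule compactum_shrink[OF X closedin_finite[OF X S] open_minus_point[OF X zX]])
      then show False
        using bC'(2)[of P "topspace (obj G ?D)"] d z(1) by auto
    qed
    moreover have clS: "closedin ?Z S"
      using S(1) SV0 tZ by (intro closedin_finite[OF cZ]) simp_all
    ultimately have "b \<in> carried G ?Z S"
      using in_carried_iff[OF cZ clS b] by simp
    moreover have "S \<subseteq> topspace ?Z"
      using SV0 unfolding tZ .
    ultimately obtain e where e: "e \<in> topspace (obj G ?D)" "b = mor G ?D ?Z id e"
      using carried_finite_iff[OF cZ S(1)] by blast
    have "mor G ?Z ?D r b = mor G ?D ?D id e"
      unfolding e(2) by (rule mor_comp[OF cD cZ cD DZ rD e(1)]) (use r V(2) in simp)
    then have re: "mor G ?Z ?D r b = e"
      using mor_ident[OF cD e(1), of id] by simp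
    have "e = d"
    proof (rule ccontr)
      assume "e \<noteq> d"
      have cld: "closedin (obj G ?D) {d}"
        using d by (intro closedin_finite[OF GD]) simp_all
      from \<open>e \<noteq> d\<close> have "{d} \<subseteq> topspace (obj G ?D) - {e}"
        using d by blast
      then obtain Q where "openin (obj G ?D) Q" "{d} \<subseteq> Q" "obj G ?D closure_of Q \<subseteq> topspace (obj G ?D) - {e}"
        by (rule compactum_shrink[OF GD cld open_minus_point[OF GD e(1)]])
      then show False
        using bC'(3)[of "topspace X" Q] S(2) re by auto
    qed
    have "mor G ?Z X id b = mor G ?D X id e"
      unfolding e(2) by (rule mor_comp[OF cD cZ X DZ ZX e(1)]) simp
    also have "\<dots> = mor G ?A X f c"
      unfolding \<open>e = d\<close> d_def by (rule mor_comp[OF cA cD X AD DX c]) simp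
    finally have "mor G ?Z X id b \<in> N"
      using N(2) by simp
    then show False
      using bC'(1)[of "topspace X" "topspace (obj G ?D)"] S(2) d by simp
  qed
  then obtain PQ where "PQ \<in> J" "C PQ = {}"
    by (rule bexE)
  moreover obtain P Q where "PQ = (P, Q)"
    by (rule prod.exhaust)
  ultimately have PQ: "(P, Q) \<in> J" and empty: "C (P, Q) = {}"
    by simp_all
  then have P: "openin X P" "S \<subseteq> P" and Q: "openin (obj G ?D) Q" "d \<in> Q"
    by (simp_all add: J_def)
  define U where "U x = P \<inter> P0 \<inter> V (f x)" for x
  define W where "W = {c' \<in> topspace (obj G ?A). mor G ?A ?D f c' \<in> Q}"
  show ?thesis
  proof (intro exI[of _ U] exI[of _ W] conjI ballI allI impI)
    fix x assume "x \<in> A"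
    then have "f x \<in> S"
      by (simp add: S_def)
    then show "openin X (U x)" "f x \<in> U x"
      unfolding U_def using P P0(1,2) V(1,2) by (auto intro!: openin_Int)
  next
    show "openin (obj G ?A) W"
      unfolding W_def by (rule openin_continuous_map_preimage[OF mor_continuous[OF cA cD AD] Q(1)])
    show "c \<in> W"
      unfolding W_def using c Q(2) by (simp add: d_def)
    fix g c' assume gU: "\<forall>x\<in>A. g x \<in> U x" and "c' \<in> W"
    then have c': "c' \<in> topspace (obj G ?A)" "mor G ?A ?D f c' \<in> Q"
      by (simp_all add: W_def)
    have g: "g x \<in> P" "g x \<in> V0" "r (g x) = f x" if "x \<in> A" for x
      using bspec[OF gU that] V0(2) r[of "f x" "g x"] that by (auto simp: U_def S_def)
    have AZ: "continuous_map ?A ?Z g"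
      unfolding continuous_map_discrete_domain tZ using g(2) by (rule image_subsetI)
    define b where "b = mor G ?A ?Z g c'"
    have b: "b \<in> topspace (obj G ?Z)"
      unfolding b_def by (rule mor_in[OF cA cZ AZ c'(1)])
    have "g ` topspace ?A \<subseteq> V0 \<inter> X closure_of P"
    proof (rule image_subsetI)
      fix x assume "x \<in> topspace ?A"
      then have "x \<in> A"
        by simp
      then show "g x \<in> V0 \<inter> X closure_of P"
        using g(2) subsetD[OF closure_of_subset[OF openin_subset[OF P(1)]] g(1)] by (intro IntI)
    qed
    then have "b \<in> carried G ?Z (V0 \<inter> X closure_of P)"
      unfolding b_def by (rule mor_in_carried[OF cA cZ clZ AZ _ c'(1)])
    moreover have "mor G ?Z ?D r b = mor G ?A ?D f c'"
      unfolding b_def by (rule mor_comp[OF cA cZ cD AZ rD c'(1)]) (use g(3) in simp)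
    then have "mor G ?Z ?D r b \<in> obj G ?D closure_of Q"
      using c'(2) closure_of_subset[OF openin_subset[OF Q(1)]] by auto
    moreover have "mor G ?Z X id b \<in> topspace (obj G X)"
      by (rule mor_in[OF cZ X ZX b])
    moreover have "b \<notin> C (P, Q)"
      using empty by simp
    ultimately have "mor G ?Z X id b \<in> N"
      using b by (simp add: C_def)
    moreover have "mor G ?Z X id b = mor G ?A X g c'"
      unfolding b_def by (rule mor_comp[OF cA cZ X AZ ZX c'(1)]) simp
    ultimately show "mor G ?A X g c' \<in> N"
      by simp
  qed
qed

end

section \<open>Weight of the values\<close>

context compacta_functor
begin

text \<open>
  A finite discrete space embeds into an infinite compactum of countable weight. Its value therefore
  embeds into the value of that compactum, which has countable weight and so is metrizable.
\<close>

lemma preserves_weight_imp_metrizable: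
  assumes mono: "monomorphic G" and weight: "preserves_weight G"
  shows "metrizable_space (obj G (ordinal n))"
proof -
  obtain X :: "'a topology" where X: "compactum X" "infinite (topspace X)" "second_countable X"
    using infinite_second_countable_compactum .
  have "weight (obj G X) =o weight X"
    using weight X unfolding preserves_weight_def by blast
  then have "second_countable (obj G X)"
    by (rule second_countable_of_weight_eq[OF X(3)])
  then have metr: "metrizable_space (obj G X)"
    by (rule second_countable_imp_metrizable[OF obj_compactum[OF X(1)]])
  obtain e :: "nat \<Rightarrow> 'a" where e: "inj e" "range e \<subseteq> topspace X"
    using infinite_countable_subset[OF X(2)] by blast
  define f where "f x = e (inv ord_pt x)" for x :: 'a
  have f: "f (ord_pt i) = e i" for i
    by (simp add: f_def inv_f_f[OF inj_ord_pt])
  let ?n = "ordinal n :: 'a topology"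
  have fX: "continuous_map ?n X f"
    unfolding continuous_map_ordinal f using e(2) by blast
  have "inj_on f (topspace ?n)"
    using e(1) by (auto simp: topspace_ordinal inj_on_def f)
  then have "inj_on (mor G ?n X f) (topspace (obj G ?n))"
    using mono compactum_ordinal X(1) fX unfolding monomorphic_def by blast
  then have "embedding_map (obj G ?n) (obj G X) (mor G ?n X f)"
    using mor_continuous[OF compactum_ordinal X(1) fX] obj_compactum[OF compactum_ordinal]
      obj_compactum[OF X(1)]
    by (intro continuous_imp_embedding_map) (simp_all add: compactum_def)
  then have "obj G ?n homeomorphic_space subtopology (obj G X) (mor G ?n X f ` topspace (obj G ?n))"
    by (rule embedding_map_imp_homeomorphic_space)
  then show ?thesis
    using homeomorphic_metrizable_space metrizable_space_subtopology[OF metr] by blast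
qed

end

context maximal_functor
begin

text \<open>
  Every element of \<open>G X\<close> has the form \<open>G f c\<close> with \<open>f\<close> defined on a finite ordinal. By joint continuity
  the images of boxes of basic open sets and members of a countable network of \<open>G n\<close> form a network.
\<close>

lemma weight_obj_le:
  assumes X: "compactum X" "infinite (topspace X)"
    and metr: "\<And>n. metrizable_space (obj G (ordinal n))"
  shows "weight (obj G X) \<le>o weight X"
proof -
  obtain \<B> where B: "is_base X \<B>" "weight X = |\<B>|"
    using weight_least_base by metis
  have infB: "infinite \<B>"
    using infinite_network[OF _ X(2) base_imp_network[OF B(1)]] X(1) by (simp add: compactum_def)
  have "\<exists>\<M>. countable \<M> \<and> network (obj G (ordinal n)) \<M>" for n
    using metrizable_countable_network[OF _ metr] obj_compactum[OF compactum_ordinal]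
    unfolding compactum_def by metis
  then obtain \<M> where M: "countable (\<M> n)" "network (obj G (ordinal n)) (\<M> n)" for n
    by metis
  define \<Phi> where "\<Phi> = (\<lambda>(us, W). {mor G (ordinal (length us)) X g c | g c.
    (\<forall>i<length us. g (ord_pt i) \<in> us ! i) \<and> c \<in> W})"
  define \<N> where "\<N> = \<Phi> ` (SIGMA us : lists \<B>. \<M> (length us))"
  have "|SIGMA us : lists \<B>. \<M> (length us)| \<le>o |\<B>|"
    by (rule card_of_Sigma_ordLeq_infinite[OF infB card_of_lists_le[OF infB ordLeq_refl[OF card_of_Card_order]]])
      (intro ballI countable_card_le[OF M(1) infB])
  then have "|\<N>| \<le>o |\<B>|"
    unfolding \<N>_def by (rule ordLeq_transitive[OF card_of_image])
  moreover have "network (obj G X) \<N>"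
    unfolding network_def
  proof (intro allI impI, elim conjE)
    fix N b assume N: "openin (obj G X) N" "b \<in> N"
    then have "b \<in> topspace (obj G X)"
      using openin_subset[OF N(1)] by blast
    then obtain n f c where f: "f ` ord_pt ` {..<n} \<subseteq> topspace X"
        and c: "c \<in> topspace (obj G (ordinal n))" and b: "b = mor G (ordinal n) X f c"
      by (rule from_ordinal[OF X(1)])
    have fin: "finite (ord_pt ` {..<n} :: 'a set)"
      by simp
    have bN: "mor G (ordinal n) X f c \<in> N"
      using N(2) unfolding b .
    obtain U W where U: "\<forall>x\<in>ord_pt ` {..<n}. openin X (U x) \<and> f x \<in> U x"
        and W: "openin (obj G (ordinal n)) W" "c \<in> W"
        and UW: "\<forall>g. (\<forall>x\<in>ord_pt ` {..<n}. g x \<in> U x) \<longrightarrow> (\<forall>c'\<in>W. mor G (ordinal n) X g c' \<in> N)"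
      using joint_continuity[OF fin X(1) f, folded ordinal_def, OF c N(1) bN] by (elim exE conjE)
    have "\<forall>i\<in>{..<n}. \<exists>u. u \<in> \<B> \<and> f (ord_pt i) \<in> u \<and> u \<subseteq> U (ord_pt i)"
    proof
      fix i assume "i \<in> {..<n}"
      then have "ord_pt i \<in> ord_pt ` {..<n}"
        by (rule imageI)
      from bspec[OF U this] obtain u where "u \<in> \<B>" "f (ord_pt i) \<in> u" "u \<subseteq> U (ord_pt i)"
        using networkD[OF base_imp_network[OF B(1)]] by metis
      then show "\<exists>u. u \<in> \<B> \<and> f (ord_pt i) \<in> u \<and> u \<subseteq> U (ord_pt i)"
        by (intro exI conjI)
    qed
    from bchoice[OF this] obtain u where
      u: "\<forall>i\<in>{..<n}. u i \<in> \<B> \<and> f (ord_pt i) \<in> u i \<and> u i \<subseteq> U (ord_pt i)"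
      by (rule exE)
    define us where "us = map u [0..<n]"
    have us: "length us = n" "us \<in> lists \<B>" "\<And>i. i < n \<Longrightarrow> us ! i = u i"
      using u by (auto simp: us_def)
    obtain W' where W': "W' \<in> \<M> n" "c \<in> W'" "W' \<subseteq> W"
      using networkD[OF M(2) W] by (elim bexE conjE)
    have "\<Phi> (us, W') \<in> \<N>"
      unfolding \<N>_def using us W'(1) by (intro imageI SigmaI) simp_all
    moreover have \<Phi>_eq: "\<Phi> (us, W') = {mor G (ordinal n) X g c' | g c'. (\<forall>i<n. g (ord_pt i) \<in> u i) \<and> c' \<in> W'}"
      by (simp add: \<Phi>_def us(1,3))
    have "b \<in> \<Phi> (us, W')"
      unfolding \<Phi>_eq b using u W'(2) by (intro CollectI exI[of _ f] exI[of _ c]) simp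
    moreover have "\<Phi> (us, W') \<subseteq> N"
    proof
      fix z assume "z \<in> \<Phi> (us, W')"
      then obtain g c' where z: "z = mor G (ordinal n) X g c'" and g: "\<forall>i<n. g (ord_pt i) \<in> u i"
          and c': "c' \<in> W'"
        unfolding \<Phi>_eq by (elim CollectE exE conjE)
      have "\<forall>x\<in>ord_pt ` {..<n}. g x \<in> U x"
      proof (intro ballI, elim imageE)
        fix x i assume "x = (ord_pt i :: 'a)" "i \<in> {..<n}"
        then show "g x \<in> U x"
          using g u by (simp add: subset_iff)
      qed
      then show "z \<in> N"
        unfolding z using UW subsetD[OF W'(3) c'] by simp
    qed
    ultimately show "\<exists>P\<in>\<N>. b \<in> P \<and> P \<subseteq> N"
      by (intro bexI[of _ "\<Phi> (us, W')"] conjI)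
  qed
  ultimately show ?thesis
    unfolding B(2) by (intro weight_le_network[OF obj_compactum[OF X(1)] _ infB])
qed

text \<open>
  Let \<open>c\<close> be an element with full support over the finite set \<open>S\<close>. Embed \<open>S\<close> in \<open>X\<close> and move the point
  \<open>s0\<close> of \<open>S\<close> to \<open>x\<close>, keeping the image \<open>Z\<close> of the others. For \<open>x\<close> outside \<open>Z\<close> the resulting element
  has the support \<open>Z \<union> {x}\<close> and so determines \<open>x\<close>.
\<close>

lemma weight_le_obj:
  assumes X: "compactum X" "infinite (topspace X)"
    and Y: "compactum Y" and a: "a \<in> topspace (obj G Y)" and nonempty: "supp Y a \<noteq> {}"
  shows "weight X \<le>o weight (obj G X)"
proof -
  define S where "S = supp Y a"
  have S: "finite S" "S \<subseteq> topspace Y"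
    unfolding S_def by (rule finite_supp[OF Y a] supp_subset[OF Y a])+
  let ?S = "discrete_topology S"
  have cS: "compactum ?S"
    by (rule compactum_finite_discrete[OF S(1)])
  have SY: "continuous_map ?S Y id"
    unfolding continuous_map_discrete_domain using S(2) by simp
  have supp_a: "supp Y a = S"
    by (simp add: S_def)
  obtain c where c: "c \<in> topspace (obj G ?S)" "mor G ?S Y id c = a"
    using in_carried_supp[OF Y a] carried_finite_iff[OF Y S, of a] unfolding supp_a by metis
  have "supp Y (mor G ?S Y id c) = id ` supp ?S c"
    by (rule supp_mor_inj[OF cS Y SY _ c(1)]) simp
  then have supp_c: "supp ?S c = S"
    unfolding c(2) supp_a by simp
  obtain s0 where s0: "s0 \<in> S"
    using nonempty unfolding supp_a by blast
  obtain z where z: "z ` S \<subseteq> topspace X" "inj_on z S"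
  proof -
    obtain T where T: "T \<subseteq> topspace X" "finite T" "card T = card S"
      using infinite_arbitrarily_large[OF X(2)] by blast
    then obtain z where "bij_betw z S T"
      using finite_same_card_bij[OF S(1), of T] by auto
    with T(1) show ?thesis
      by (intro that[of z]) (simp_all add: bij_betw_def)
  qed
  define Z where "Z = z ` (S - {s0})"
  have Z: "finite Z" "Z \<subseteq> topspace X"
    using S(1) z(1) by (auto simp: Z_def)
  define f where "f x = z(s0 := x)" for x
  have f_im: "f x ` S = insert x Z" for x
    using s0 by (auto simp: f_def Z_def)
  have f: "continuous_map ?S X (f x)" if "x \<in> topspace X" for x
    unfolding continuous_map_discrete_domain f_im using that Z(2) by blast
  define h where "h x = mor G ?S X (f x) c" for x
  have h: "h x \<in> topspace (obj G X)" if "x \<in> topspace X" for x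
    unfolding h_def by (rule mor_in[OF cS X(1) f[OF that] c(1)])
  have h_cont: "continuous_map X (obj G X) h"
    unfolding continuous_map_eq_topcontinuous_at topcontinuous_at_def
  proof (intro ballI conjI allI impI)
    fix x N assume x: "x \<in> topspace X" and "openin (obj G X) N \<and> h x \<in> N"
    then have N: "openin (obj G X) N" "h x \<in> N"
      by simp_all
    have fx: "f x ` S \<subseteq> topspace X"
      unfolding f_im using x Z(2) by simp
    obtain U W where "\<forall>t\<in>S. openin X (U t) \<and> f x t \<in> U t" and W: "c \<in> W"
      and UW: "\<forall>g. (\<forall>t\<in>S. g t \<in> U t) \<longrightarrow> (\<forall>c'\<in>W. mor G ?S X g c' \<in> N)"
      using joint_continuity[OF S(1) X(1) fx c(1) N(1) N(2)[unfolded h_def]] by (elim exE conjE)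
    then have U: "openin X (U t)" "f x t \<in> U t" if "t \<in> S" for t
      using that by simp_all
    have "h y \<in> N" if "y \<in> U s0" for y
    proof -
      have "f y t \<in> U t" if "t \<in> S" for t
        using U(2)[OF that] \<open>y \<in> U s0\<close> by (cases "t = s0") (simp_all add: f_def)
      then show ?thesis
        unfolding h_def using UW W by simp
    qed
    moreover have "x \<in> U s0"
      using U(2)[OF s0] by (simp add: f_def)
    ultimately show "\<exists>U. openin X U \<and> x \<in> U \<and> (\<forall>y\<in>U. h y \<in> N)"
      using U(1)[OF s0] by (intro exI[of _ "U s0"]) simp
  qed (use h in simp_all)
  have supp_h: "supp X (h x) = insert x Z" if x: "x \<in> topspace X - Z" for x
  proof -
    have "inj_on (f x) (topspace ?S)"
      using x z(2) unfolding f_def Z_def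
      by (simp add: inj_on_def) blast
    then have "supp X (h x) = f x ` supp ?S c"
      unfolding h_def using x by (intro supp_mor_inj[OF cS X(1) f _ c(1)]) simp_all
    then show ?thesis
      by (simp add: supp_c f_im)
  qed
  have h_eq: "x = y" if xy: "x \<in> topspace X - Z" "y \<in> topspace X" "h x = h y" for x y
  proof -
    have "supp X (h y) \<subseteq> insert y Z"
      using supp_mor_subset[OF cS X(1) f[OF xy(2)] c(1)] by (simp add: supp_c f_im h_def)
    then show ?thesis
      using supp_h[OF xy(1)] xy by auto
  qed
  obtain \<B> where B: "is_base (obj G X) \<B>" "weight (obj G X) = |\<B>|"
    using weight_least_base by metis
  have "infinite (topspace (obj G X))"
  proof
    assume "finite (topspace (obj G X))"
    moreover have "h ` (topspace X - Z) \<subseteq> topspace (obj G X)"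
      by (rule image_subsetI) (simp add: h)
    ultimately have "finite (h ` (topspace X - Z))"
      by (rule rev_finite_subset)
    moreover have "inj_on h (topspace X - Z)"
      by (rule inj_onI) (rule h_eq; simp)
    ultimately have "finite (topspace X - Z)"
      by (rule finite_imageD)
    then show False
      using X(2) Z(1) by simp
  qed
  then have infB: "infinite \<B>"
    using infinite_network[OF _ _ base_imp_network[OF B(1)]] obj_compactum[OF X(1)]
    by (simp add: compactum_def)
  \<comment> \<open>The points of \<open>Z\<close>, where \<open>h\<close> may fail to be injective, are added as singletons.\<close>
  define \<N> where "\<N> = (\<lambda>P. {x \<in> topspace X - Z. h x \<in> P}) ` \<B> \<union> (\<lambda>x. {x}) ` Z"
  have "|(\<lambda>P. {x \<in> topspace X - Z. h x \<in> P}) ` \<B>| \<le>o |\<B>|"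
    by (rule card_of_image)
  moreover have "|(\<lambda>x. {x}) ` Z| \<le>o |\<B>|"
    by (rule countable_card_le[OF countable_finite[OF finite_imageI[OF Z(1)]] infB])
  ultimately have "|\<N>| \<le>o |\<B>|"
    unfolding \<N>_def using infB
    by (intro card_of_Un_ordLeq_infinite_Field card_of_Card_order) (simp_all only: Field_card_of not_False_eq_True)
  moreover have "network X \<N>"
    unfolding network_def
  proof (intro allI impI, elim conjE)
    fix U x assume U: "openin X U" "x \<in> U"
    have xX: "x \<in> topspace X"
      using openin_subset[OF U(1)] U(2) by blast
    show "\<exists>P\<in>\<N>. x \<in> P \<and> P \<subseteq> U"
    proof (cases "x \<in> Z")
      case True
      then show ?thesis
        using U(2) unfolding \<N>_def by (intro bexI[of _ "{x}"]) auto
    next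
      case False
      then have x: "x \<in> topspace X - Z"
        using xX by simp
      define O' where "O' = topspace (obj G X) - h ` (topspace X - U)"
      have "closedin (obj G X) (h ` (topspace X - U))"
        using U(1) by (intro closedin_continuous_image[OF X(1) obj_compactum[OF X(1)] h_cont] closedin_diff) simp_all
      then have "openin (obj G X) O'"
        unfolding O'_def by (intro openin_diff openin_topspace)
      moreover have "h x \<in> O'"
        unfolding O'_def using h[OF xX] h_eq[OF x] U(2) by auto
      ultimately obtain P where P: "P \<in> \<B>" "h x \<in> P" "P \<subseteq> O'"
        using networkD[OF base_imp_network[OF B(1)]] by metis
      have "{y \<in> topspace X - Z. h y \<in> P} \<subseteq> U"
        using P(3) unfolding O'_def by blast
      moreover have "{y \<in> topspace X - Z. h y \<in> P} \<in> \<N>"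
        unfolding \<N>_def by (rule UnI1) (rule image_eqI[OF refl P(1)])
      ultimately show ?thesis
        using x P(2) by (intro bexI[of _ "{y \<in> topspace X - Z. h y \<in> P}"]) simp_all
    qed
  qed
  ultimately show ?thesis
    unfolding B(2) by (intro weight_le_network[OF X(1) _ infB])
qed

text \<open>
  All maps agree on the empty space.
\<close>

lemma mor_cong_carried_empty:
  assumes "compactum X" "compactum Y" "continuous_map X Y f" "continuous_map X Y g"
    and a: "a \<in> carried G X {}"
  shows "mor G X Y f a = mor G X Y g a"
proof -
  let ?E = "subtopology X {}"
  obtain e where e: "e \<in> topspace (obj G ?E)" "a = mor G ?E X id e"
    using a unfolding carried_def by blast
  have cE: "compactum ?E"
    using assms(1) by (intro compactum_closed_subspace) simp_all
  have EX: "continuous_map ?E X id"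
    by (intro continuous_map_from_subtopology continuous_map_id)
  have "mor G X Y f a = mor G ?E Y g e" "mor G X Y g a = mor G ?E Y g e"
    unfolding e(2) by (rule mor_comp[OF cE assms(1,2) EX _ e(1)]; use assms in simp)+
  then show ?thesis
    by simp
qed

text \<open>
  If every element comes from the empty space, then the map to a point and the map from the point
  induce mutually inverse bijections with the elements over the point that come from the empty space.
\<close>

lemma essentially_constant_if_empty_supports:
  assumes emp: "\<And>X a. compactum X \<Longrightarrow> a \<in> topspace (obj G X) \<Longrightarrow> supp X a = {}"
  shows "essentially_constant G"
proof -
  let ?I = "ordinal 1 :: 'a topology" and ?p = "\<lambda>_ :: 'a. ord_pt 0 :: 'a"
  define K where "K = subtopology (obj G ?I) (carried G ?I {})"
  define \<eta> where "\<eta> X = mor G X ?I ?p" for X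
  have tI: "topspace ?I = {ord_pt 0}"
    by (auto simp: topspace_ordinal)
  have p: "continuous_map X ?I ?p" for X :: "'a topology"
    using tI by (intro continuous_map_constant) simp
  have clI: "closedin ?I {}"
    by simp
  have tK: "topspace K = carried G ?I {}"
    unfolding K_def using carried_subset[OF compactum_ordinal clI] by auto
  have emp': "a \<in> carried G X {}" if "compactum X" "a \<in> topspace (obj G X)" for X a
    using in_carried_supp[OF that] emp[OF that] by simp
  have hom: "homeomorphic_map (obj G X) K (\<eta> X)" if X: "compactum X" "topspace X \<noteq> {}" for X
  proof -
    obtain x where x: "x \<in> topspace X"
      using X(2) by blast
    then have xc: "continuous_map Y X (\<lambda>_. x)" for Y :: "'a topology"
      by (rule continuous_map_constant)
    have \<eta>_in: "\<eta> X a \<in> carried G ?I {}" if "a \<in> topspace (obj G X)" for a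
      unfolding \<eta>_def
      by (rule mor_carried[OF X(1) compactum_ordinal p _ clI _ emp'[OF X(1) that]]) simp_all
    have recover: "mor G ?I X (\<lambda>_. x) (\<eta> X a) = a" if a: "a \<in> topspace (obj G X)" for a
    proof -
      have "mor G ?I X (\<lambda>_. x) (\<eta> X a) = mor G X X (\<lambda>_. x) a"
        unfolding \<eta>_def by (rule mor_comp[OF X(1) compactum_ordinal X(1) p xc a]) simp
      also have "\<dots> = mor G X X id a"
        by (rule mor_cong_carried_empty[OF X(1) X(1) xc continuous_map_id emp'[OF X(1) a]])
      also have "\<dots> = a"
        by (rule mor_ident[OF X(1) a]) simp
      finally show ?thesis .
    qed
    show ?thesis
    proof (rule continuous_imp_homeomorphic_map)
      show "continuous_map (obj G X) K (\<eta> X)"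
        unfolding K_def continuous_map_in_subtopology
        using mor_continuous[OF X(1) compactum_ordinal p] \<eta>_in by (simp add: \<eta>_def)
      show "compact_space (obj G X)" "Hausdorff_space K"
        using obj_compactum[OF X(1)] obj_compactum[OF compactum_ordinal]
        by (simp_all add: K_def compactum_def Hausdorff_space_subtopology)
      show "inj_on (\<eta> X) (topspace (obj G X))"
        by (rule inj_on_inverseI) (rule recover)
      show "\<eta> X ` topspace (obj G X) = topspace K"
        unfolding tK
      proof (intro equalityI subsetI)
        fix e assume e: "e \<in> carried G ?I {}"
        then have e': "e \<in> topspace (obj G ?I)"
          using carried_subset[OF compactum_ordinal clI] by blast
        have "\<eta> X (mor G ?I X (\<lambda>_. x) e) = mor G ?I ?I ?p e"
          unfolding \<eta>_def by (rule mor_comp[OF compactum_ordinal X(1) compactum_ordinal xc p e']) simp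
        also have "\<dots> = e"
          by (rule mor_ident[OF compactum_ordinal e']) (simp only: tI singleton_iff)
        finally have "\<eta> X (mor G ?I X (\<lambda>_. x) e) = e" .
        from image_eqI[where f = "\<eta> X", OF this[symmetric] mor_in[OF compactum_ordinal X(1) xc e']]
        show "e \<in> \<eta> X ` topspace (obj G X)" .
      next
        fix e assume "e \<in> \<eta> X ` topspace (obj G X)"
        then show "e \<in> carried G ?I {}"
          by (elim imageE) (simp only: \<eta>_in)
      qed
    qed
  qed
  have nat: "\<eta> Y (mor G X Y f a) = \<eta> X a"
    if "compactum X" "compactum Y" "continuous_map X Y f" "a \<in> topspace (obj G X)" for X Y f a
    unfolding \<eta>_def by (rule mor_comp[OF that(1,2) compactum_ordinal that(3) p that(4)]) simp
  show ?thesis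
    unfolding essentially_constant_def
  proof (intro exI conjI allI impI ballI; elim conjE)
    show "homeomorphic_map (obj G X) K (\<eta> X)" if "compactum X" "topspace X \<noteq> {}" for X
      by (rule hom[OF that])
    show "\<eta> Y (mor G X Y f a) = \<eta> X a"
      if "a \<in> topspace (obj G X)" "compactum X" "compactum Y" "continuous_map X Y f" for X Y f a
      by (rule nat[OF that(2,3,4,1)])
  qed
qed

end

section \<open>The maximal modification at the empty space\<close>

text \<open>
  The value of the maximal modification at the empty space.
\<close>

definition equalizer_part :: "('a::infinite, 'b) functor_data \<Rightarrow> 'b set" where
  "equalizer_part F = {a \<in> topspace (obj F (ordinal 1)).
     mor F (ordinal 1) (ordinal 2) (\<lambda>_. ord_pt 0) a = mor F (ordinal 1) (ordinal 2) (\<lambda>_. ord_pt 1) a}"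

lemma obj_max_mod_nonempty: "topspace X \<noteq> {} \<Longrightarrow> obj (max_mod F) X = obj F X"
  by (simp add: max_mod_def)

lemma mor_max_mod_nonempty: "topspace X \<noteq> {} \<Longrightarrow> mor (max_mod F) X Y f = mor F X Y f"
  by (simp add: max_mod_def)

lemma obj_max_mod_empty:
  "topspace X = {} \<Longrightarrow> obj (max_mod F) X = subtopology (obj F (ordinal 1)) (equalizer_part F)"
  by (simp add: max_mod_def equalizer_part_def)

lemma mor_max_mod_empty:
  "topspace X = {} \<Longrightarrow> topspace Y = {} \<Longrightarrow> mor (max_mod F) X Y f = id"
  by (simp add: max_mod_def)

lemma topspace_max_mod_empty: "topspace X = {} \<Longrightarrow> topspace (obj (max_mod F) X) = equalizer_part F"
  unfolding obj_max_mod_empty topspace_subtopology by (auto simp: equalizer_part_def)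

context compacta_functor
begin

lemma equalizer_part_subset: "equalizer_part G \<subseteq> topspace (obj G (ordinal 1))"
  unfolding equalizer_part_def by blast

lemma closedin_equalizer_part: "closedin (obj G (ordinal 1)) (equalizer_part G)"
  unfolding equalizer_part_def
  using obj_compactum[OF compactum_ordinal[of 2]]
  by (intro closedin_continuous_maps_eq[of "obj G (ordinal 2)"] mor_continuous compactum_ordinal
      continuous_map_constant) (auto simp: compactum_def topspace_ordinal)

text \<open>
  The two points of \<open>2\<close> can be sent to any two points of \<open>Y\<close>, so the choice of the constant map
  out of \<open>1\<close> does not matter.
\<close>

lemma equalizer_part_constant:
  assumes Y: "compactum Y" and y: "y \<in> topspace Y" "y' \<in> topspace Y" and a: "a \<in> equalizer_part G"
  shows "mor G (ordinal 1) Y (\<lambda>_. y) a = mor G (ordinal 1) Y (\<lambda>_. y') a"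
proof -
  let ?I = "ordinal 1 :: 'a topology" and ?II = "ordinal 2 :: 'a topology"
  have a': "a \<in> topspace (obj G ?I)"
    using a equalizer_part_subset by blast
  define h where "h x = (if x = ord_pt 0 then y else y')" for x :: 'a
  have h: "continuous_map ?II Y h"
    unfolding continuous_map_ordinal using y by (simp add: h_def)
  have p: "continuous_map ?I ?II (\<lambda>_. ord_pt i)" if "i < 2" for i
    using that by (intro continuous_map_constant) (simp add: topspace_ordinal)
  have "ord_pt 1 \<noteq> (ord_pt 0 :: 'a)"
    by (metis inj_ord_pt injD zero_neq_one)
  then have "h (ord_pt 1) = y'"
    unfolding h_def by (rule if_not_P)
  then have "mor G ?II Y h (mor G ?I ?II (\<lambda>_. ord_pt 1) a) = mor G ?I Y (\<lambda>_. y') a"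
    by (intro mor_comp[OF compactum_ordinal compactum_ordinal Y p h a']) simp_all
  moreover have "mor G ?II Y h (mor G ?I ?II (\<lambda>_. ord_pt 0) a) = mor G ?I Y (\<lambda>_. y) a"
    by (rule mor_comp[OF compactum_ordinal compactum_ordinal Y p h a']) (simp_all add: h_def)
  ultimately show ?thesis
    using a by (simp add: equalizer_part_def)
qed

lemma mor_max_mod_empty_nonempty:
  assumes "compactum Y" "topspace X = {}" "y \<in> topspace Y" "a \<in> equalizer_part G"
  shows "mor (max_mod G) X Y f a = mor G (ordinal 1) Y (\<lambda>_. y) a"
proof -
  have ne: "topspace Y \<noteq> {}"
    using assms(3) by blast
  then have "mor (max_mod G) X Y f a = mor G (ordinal 1) Y (\<lambda>_. SOME y. y \<in> topspace Y) a"
    using assms(2) by (simp add: max_mod_def)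
  also have "\<dots> = mor G (ordinal 1) Y (\<lambda>_. y) a"
    using ne by (intro equalizer_part_constant assms(1,3,4)) (simp add: some_in_eq)
  finally show ?thesis .
qed

lemma comp_functor_max_mod: "comp_functor (max_mod G)"
  unfolding comp_functor_def
proof (intro conjI allI impI ballI; (elim conjE)?)
  let ?M = "max_mod G" and ?I = "ordinal 1 :: 'a topology"
  have const: "continuous_map ?I Y (\<lambda>_. y)" if "y \<in> topspace Y" for Y :: "'a topology" and y
    by (rule continuous_map_constant[OF that])
  fix X :: "'a topology"
  assume X: "compactum X"
  show "compactum (obj ?M X)"
  proof (cases "topspace X = {}")
    case True
    show ?thesis
      unfolding obj_max_mod_empty[OF True]
      by (rule compactum_closed_subspace[OF obj_compactum[OF compactum_ordinal] closedin_equalizer_part])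
  next
    case False
    then show ?thesis
      using obj_compactum[OF X] by (simp add: obj_max_mod_nonempty)
  qed
  show "mor ?M X X id a = a" if a: "a \<in> topspace (obj ?M X)" for a
  proof (cases "topspace X = {}")
    case True
    then show ?thesis
      by (simp add: mor_max_mod_empty)
  next
    case False
    then show ?thesis
      using a mor_ident[OF X] by (simp add: obj_max_mod_nonempty mor_max_mod_nonempty)
  qed
  fix Y :: "'a topology" and f
  assume Y: "compactum Y" and f: "continuous_map X Y f"
  show "continuous_map (obj ?M X) (obj ?M Y) (mor ?M X Y f)"
  proof (cases "topspace X = {}")
    case False
    then show ?thesis
      using mor_continuous[OF X Y f] continuous_map_nonempty[OF f False]
      by (simp add: obj_max_mod_nonempty mor_max_mod_nonempty)
  next
    case X0: True
    show ?thesis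
    proof (cases "topspace Y = {}")
      case True
      then show ?thesis
        using X0 by (simp add: mor_max_mod_empty obj_max_mod_empty)
    next
      case False
      then obtain y where y: "y \<in> topspace Y"
        by blast
      have "continuous_map (obj ?M X) (obj G Y) (mor G ?I Y (\<lambda>_. y))"
        unfolding obj_max_mod_empty[OF X0]
        by (rule continuous_map_from_subtopology[OF mor_continuous[OF compactum_ordinal Y const[OF y]]])
      then show ?thesis
        unfolding obj_max_mod_nonempty[OF False]
        by (rule continuous_map_eq)
          (simp add: topspace_max_mod_empty[OF X0] mor_max_mod_empty_nonempty[OF Y X0 y])
    qed
  qed
  fix a assume a: "a \<in> topspace (obj ?M X)"
  show "mor ?M X Y f a = mor ?M X Y g a" if "\<forall>x\<in>topspace X. f x = g x" for g
  proof (cases "topspace X = {}")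
    case True
    then show ?thesis
      by (simp add: max_mod_def)
  next
    case False
    then show ?thesis
      using a mor_cong[OF X Y f, of a g] that by (simp add: obj_max_mod_nonempty mor_max_mod_nonempty)
  qed
  fix Z :: "'a topology" and g
  assume Z: "compactum Z" and g: "continuous_map Y Z g"
  show "mor ?M X Z (g \<circ> f) a = mor ?M Y Z g (mor ?M X Y f a)"
  proof (cases "topspace X = {}")
    case False
    then show ?thesis
      using a mor_comp[OF X Y Z f g, of a "g \<circ> f"] continuous_map_nonempty[OF f False]
      by (simp add: obj_max_mod_nonempty mor_max_mod_nonempty)
  next
    case X0: True
    then have a': "a \<in> equalizer_part G"
      using a by (simp add: topspace_max_mod_empty)
    show ?thesis
    proof (cases "topspace Y = {}")
      case Y0: True
      show ?thesis
        unfolding mor_max_mod_empty[OF X0 Y0] using X0 Y0 by (simp add: max_mod_def)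
    next
      case False
      then obtain y where y: "y \<in> topspace Y"
        by blast
      have gy: "g y \<in> topspace Z"
        using g y by (auto simp: continuous_map_def)
      have "mor ?M Y Z g (mor ?M X Y f a) = mor G Y Z g (mor G ?I Y (\<lambda>_. y) a)"
        unfolding mor_max_mod_nonempty[OF False] mor_max_mod_empty_nonempty[OF Y X0 y a'] ..
      also have "\<dots> = mor G ?I Z (\<lambda>_. g y) a"
        using a' equalizer_part_subset by (intro mor_comp[OF compactum_ordinal Y Z const[OF y] g]) auto
      also have "\<dots> = mor ?M X Z (g \<circ> f) a"
        by (rule mor_max_mod_empty_nonempty[OF Z X0 gy a', symmetric])
      finally show ?thesis ..
    qed
  qed
qed

lemma monomorphic_max_mod:
  assumes mono: "monomorphic G"
  shows "monomorphic (max_mod G)"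
  unfolding monomorphic_def
proof (intro allI impI, elim conjE)
  fix X Y :: "'a topology" and f
  assume X: "compactum X" and Y: "compactum Y" and f: "continuous_map X Y f" "inj_on f (topspace X)"
  show "inj_on (mor (max_mod G) X Y f) (topspace (obj (max_mod G) X))"
  proof (cases "topspace X = {}")
    case False
    then show ?thesis
      using mono X Y f unfolding monomorphic_def by (simp add: obj_max_mod_nonempty mor_max_mod_nonempty)
  next
    case X0: True
    show ?thesis
    proof (cases "topspace Y = {}")
      case True
      then show ?thesis
        using X0 by (simp add: mor_max_mod_empty)
    next
      case False
      then obtain y where y: "y \<in> topspace Y"
        by blast
      have "inj_on (\<lambda>_. y) (topspace (ordinal 1))"
        unfolding topspace_ordinal_1 by simp
      then have "inj_on (mor G (ordinal 1) Y (\<lambda>_. y)) (topspace (obj G (ordinal 1)))"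
        using mono[unfolded monomorphic_def, rule_format, of "ordinal 1" Y "\<lambda>_. y"]
          compactum_ordinal Y continuous_map_constant[OF y] by blast
      then have "inj_on (mor G (ordinal 1) Y (\<lambda>_. y)) (equalizer_part G)"
        by (rule inj_on_subset[OF _ equalizer_part_subset])
      then show ?thesis
        unfolding topspace_max_mod_empty[OF X0]
        by (subst inj_on_cong[of _ _ "mor G (ordinal 1) Y (\<lambda>_. y)"])
          (simp_all add: mor_max_mod_empty_nonempty[OF Y X0 y])
    qed
  qed
qed

end

context finitely_supported_functor
begin

text \<open>
  The original functor may use the empty space as a carrier of elements over a non-empty space, but
  its value there has been modified. Adding a point to the carrier avoids this.
\<close>

lemma finite_supports_max_mod: "finite_supports (max_mod G)"
  unfolding finite_supports_def
proof (intro allI impI ballI)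
  let ?M = "max_mod G"
  fix X :: "'a topology" and a
  assume X: "compactum X" and a: "a \<in> topspace (obj ?M X)"
  show "\<exists>A f. finite A \<and> continuous_map (discrete_topology A) X f \<and>
    a \<in> mor ?M (discrete_topology A) X f ` topspace (obj ?M (discrete_topology A))"
  proof (cases "topspace X = {}")
    case True
    let ?E = "discrete_topology {} :: 'a topology"
    have "mor ?M ?E X id = id"
      using True by (simp add: mor_max_mod_empty)
    moreover have "topspace (obj ?M ?E) = topspace (obj ?M X)"
      using True by (simp add: topspace_max_mod_empty)
    ultimately show ?thesis
      using a by (intro exI[of _ "{}"] exI[of _ id]) simp
  next
    case False
    then obtain x0 where x0: "x0 \<in> topspace X"
      by blast
    have "a \<in> topspace (obj G X)"
      using a False by (simp add: obj_max_mod_nonempty)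
    then obtain S where S: "finite S" "S \<subseteq> topspace X" "a \<in> carried G X S"
      by (rule finite_carrier[OF X])
    let ?S = "insert x0 S"
    have S': "finite ?S" "?S \<subseteq> topspace X"
      using S x0 by auto
    have "a \<in> carried G X ?S"
      using carried_mono[OF X closedin_finite[OF X S(1,2)] closedin_finite[OF X S']] S(3) by blast
    then obtain c where "c \<in> topspace (obj G (discrete_topology ?S))" "a = mor G (discrete_topology ?S) X id c"
      using carried_finite_iff[OF X S'] by blast
    then have "a \<in> mor ?M (discrete_topology ?S) X id ` topspace (obj ?M (discrete_topology ?S))"
      by (simp add: obj_max_mod_nonempty mor_max_mod_nonempty)
    moreover have "continuous_map (discrete_topology ?S) X id"
      unfolding continuous_map_discrete_domain using S'(2) by simp
    ultimately show ?thesis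
      using S'(1) by (intro exI[of _ ?S] exI[of _ id] conjI)
  qed
qed

lemma maximal_functor_max_mod:
  assumes mono: "monomorphic G"
  shows "maximal_functor (max_mod G)"
proof (intro maximal_functor.intro finitely_supported_functor.intro compacta_functor.intro
    maximal_functor_axioms.intro finitely_supported_functor_axioms.intro)
  let ?M = "max_mod G" and ?I = "ordinal 1 :: 'a topology" and ?II = "ordinal 2 :: 'a topology"
  show "comp_functor ?M" "finite_supports ?M" "monomorphic ?M"
    by (rule comp_functor_max_mod finite_supports_max_mod monomorphic_max_mod[OF mono])+
  fix c
  assume "c \<in> topspace (obj ?M ?I)" and
    "mor ?M ?I ?II (\<lambda>_. ord_pt 0) c = mor ?M ?I ?II (\<lambda>_. ord_pt 1) c"
  then have c: "c \<in> equalizer_part G"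
    unfolding equalizer_part_def
    by (simp only: obj_max_mod_nonempty[OF ordinal_1_nonempty] mor_max_mod_nonempty[OF ordinal_1_nonempty]
        mem_Collect_eq simp_thms)
  let ?E = "subtopology ?I {}"
  have E0: "topspace ?E = {}"
    by simp
  have p: "ord_pt 0 \<in> topspace ?I"
    unfolding topspace_ordinal_1 by simp
  have "mor ?M ?E ?I id c = mor G ?I ?I (\<lambda>_. ord_pt 0) c"
    by (rule mor_max_mod_empty_nonempty[OF compactum_ordinal E0 p c])
  also have "\<dots> = c"
    using c equalizer_part_subset
    by (intro mor_ident[OF compactum_ordinal]) (auto simp only: topspace_ordinal_1 singleton_iff)
  finally show "c \<in> carried ?M ?I {}"
    unfolding carried_def topspace_max_mod_empty[OF E0] using c by (metis image_eqI)
qed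

end

lemma preserves_weight_max_mod: "preserves_weight (max_mod F) \<longleftrightarrow> preserves_weight F"
proof -
  have "obj (max_mod F) X = obj F X" if "infinite (topspace X)" for X
    using that by (intro obj_max_mod_nonempty) auto
  then show ?thesis
    unfolding preserves_weight_def by auto
qed

lemma essentially_constant_max_mod:
  fixes F :: "('a::infinite, 'b) functor_data"
  assumes "essentially_constant (max_mod F)"
  shows "essentially_constant F"
proof -
  obtain K :: "'b topology" and \<eta> where
    hom: "\<forall>X. compactum X \<and> topspace X \<noteq> {} \<longrightarrow> homeomorphic_map (obj (max_mod F) X) K (\<eta> X)" and
    nat: "\<forall>X Y f. compactum X \<and> topspace X \<noteq> {} \<and> compactum Y \<and> continuous_map X Y f
       \<longrightarrow> (\<forall>a\<in>topspace (obj (max_mod F) X). \<eta> Y (mor (max_mod F) X Y f a) = \<eta> X a)"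
    using assms unfolding essentially_constant_def by (elim exE conjE)
  show ?thesis
    unfolding essentially_constant_def
  proof (intro exI conjI allI impI; elim conjE)
    show "homeomorphic_map (obj F X) K (\<eta> X)" if X: "compactum X" "topspace X \<noteq> {}" for X
      using hom[THEN spec, THEN mp, OF conjI[OF X]] unfolding obj_max_mod_nonempty[OF X(2)] .
    show "\<forall>a\<in>topspace (obj F X). \<eta> Y (mor F X Y f a) = \<eta> X a"
      if f: "compactum X" "topspace X \<noteq> {}" "compactum Y" "continuous_map X Y f" for X Y f
      using nat[THEN spec, THEN spec, THEN spec, THEN mp, OF conjI[OF f(1) conjI[OF f(2) conjI[OF f(3,4)]]]]
      unfolding obj_max_mod_nonempty[OF f(2)] mor_max_mod_nonempty[OF f(2)] .
  qed
qed

context maximal_functor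
begin

lemma metrizable_imp_preserves_weight:
  assumes metr: "\<And>n. metrizable_space (obj G (ordinal n))" and nonconst: "\<not> essentially_constant G"
  shows "preserves_weight G"
proof -
  have "\<exists>Y a. compactum Y \<and> a \<in> topspace (obj G Y) \<and> supp Y a \<noteq> {}"
  proof (rule ccontr)
    assume "\<not> ?thesis"
    then have "essentially_constant G"
      by (intro essentially_constant_if_empty_supports) simp
    with nonconst show False ..
  qed
  then obtain Y a where Y: "compactum Y" "a \<in> topspace (obj G Y)" "supp Y a \<noteq> {}"
    by (elim exE conjE)
  show ?thesis
    unfolding preserves_weight_def
  proof (intro allI impI, elim conjE)
    fix X :: "'a topology" assume X: "compactum X" "infinite (topspace X)"
    show "weight (obj G X) =o weight X"
      unfolding ordIso_iff_ordLeq by (intro conjI weight_obj_le[OF X metr] weight_le_obj[OF X Y])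
  qed
qed

end

theorem theorem4:
  fixes F :: "('a::infinite, 'b) functor_data"
  assumes "comp_functor F" and "monomorphic F" and "finite_supports F"
  shows "(comp_functor (max_mod F) \<and> monomorphic (max_mod F) \<and> epimorphic (max_mod F) \<and>
          continuous_functor TYPE('i) (max_mod F) \<and> preserves_intersections (max_mod F) \<and>
          finite_supports (max_mod F))
       \<and> (\<not> essentially_constant F \<longrightarrow>
            (preserves_weight F \<and> preserves_weight (max_mod F)
               \<longleftrightarrow> (\<forall>n. metrizable_space (obj F (ordinal n)))))
       \<and> (preserves_weight F \<or> preserves_weight (max_mod F) \<longrightarrow>
            (\<forall>n. metrizable_space (obj F (ordinal n))))"
proof -
  interpret F: finitely_supported_functor F
    using assms(1,3) by unfold_locales
  interpret M: maximal_functor "max_mod F"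
    by (rule F.maximal_functor_max_mod[OF assms(2)])
  have necessary: "\<forall>n. metrizable_space (obj F (ordinal n))" if "preserves_weight F"
    using F.preserves_weight_imp_metrizable[OF assms(2) that] by simp
  have sufficient: "preserves_weight F"
    if nonconst: "\<not> essentially_constant F" and metr: "\<forall>n. metrizable_space (obj F (ordinal n))"
  proof -
    have "metrizable_space (obj (max_mod F) (ordinal n))" for n
    proof (cases "topspace (ordinal n :: 'a topology) = {}")
      case True
      then show ?thesis
        unfolding obj_max_mod_empty[OF True] using metr by (intro metrizable_space_subtopology) simp
    next
      case False
      then show ?thesis
        using metr by (simp add: obj_max_mod_nonempty)
    qed
    then have "preserves_weight (max_mod F)"
      using nonconst essentially_constant_max_mod by (intro M.metrizable_imp_preserves_weight) blast+
    then show ?thesis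
      unfolding preserves_weight_max_mod .
  qed
  show ?thesis
    unfolding preserves_weight_max_mod
    using F.comp_functor_max_mod F.monomorphic_max_mod[OF assms(2)] F.finite_supports_max_mod
      M.is_epimorphic M.is_continuous M.is_intersection_preserving necessary sufficient by blast
qed

end
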